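(* Let $(M,d)$ be a Hadamard space. Let $\sigma$ be a topology on $M$ compatible with $(M,d)$. Let $F,G:M\rightarrow(-\infty,\infty]$ be two convex lower semicontinuous functions such that $F\leq G$ and such that $G$ is decreasing (i.e. non-increasing) along the gradient flow of $F$. Fix an arbitrary point $x_0\in \operatorname{Dom} G$. Assume that for any constant $C>0$, the set $$\mathcal{K}_{C}:=\{x\in M: d(x,x_0)\leq C,\ G(x)\leq C\}\subseteq M$$ is $\sigma$-sequentially compact. Then $$\inf_{x\in M} |\partial F|(x)=\max\left(0,\max_{\ell\in \mathcal{R}\setminus\{0\}}\frac{-\mathbf{F}(\ell)}{\|\ell\|}\right).$$
   Context: A Hadamard space is a complete geodesic CAT(0) metric space. For $G:M\to(-\infty,\infty]$, $\operatorname{Dom}G=G^{-1}(\mathbb{R})$. Weak convergence: a bounded sequence $(x_j)$ in $M$ converges weakly to $x\in M$ if for every subsequence $(x_{j_k})$, $x$ is the unique minimizer of $y\mapsto\limsup_k d(y,x_{j_k})$. A topology $\sigma$ on $M$ is compatible with $(M,d)$ if: (1) $\sigma$ is Hausdorff; (2) $\sigma$ is weaker than the $d$-topology, and if $(x_j)$ is a bounded sequence in $(M,d)$ with $x_j\to x\in M$ in $\sigma$, then $x_j\to x$ weakly; (3) for any bounded $\sigma$-convergent sequences $x_j\to x$, $y_j\to y$ in $M$, $d(x,y)\le\liminf_{j\to\infty}d(x_j,y_j)$; (4) if $(x^j_t)_{t\in[0,1]}$, $j\ge1$, are geodesics in $M$ with $x^j_0\to x_0$, $x^j_1\to x_1$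 in $\sigma$, with $x_0,x_1\in M$, and $(x_t)_{t\in[0,1]}$ is the geodesic from $x_0$ to $x_1$, then $x^j_t\to x_t$ in $\sigma$ for every $t\in[0,1]$. Slope of $F$: $|\partial F|(y)=\limsup_{z\to y}\frac{\max\{F(y)-F(z),0\}}{d(y,z)}$ if $y\in\operatorname{Dom}F$, and $|\partial F|(y)=\infty$ otherwise. (Weak) gradient flow of $F$ from $c_0\in\operatorname{Dom}F$: $c_t=\lim_{m\to\infty}(J_{t/m})^m c_0$, where $J_\tau(u)$ is the minimizer of $v\mapsto\frac12d(u,v)^2+\tau F(v)$. $\mathcal{R}$ is the space of all geodesic rays $\ell=(\ell_t)_{t\ge0}$ in $M$ emanating from $x_0$ (i.e. $\ell_0=x_0$ and $d(\ell_s,\ell_t)=c|s-t|$ for a constant $c\ge0$), $0$ is the constant ray, $\|\ell\|=d(\ell_0,\ell_1)$, and $\mathbf{F}:\mathcal{R}\to(-\infty,\infty]$ is $\mathbf{F}(\ell)=\lim_{t\to\infty}F(\ell_t)/t$. The expression $\max(0,\max_{\ell}q(\ell))$ on the right-hand side denotes the maximum of the set $\{0\}\cup\{q(\ell):\ell\in\mathcal{R}\setminus\{0\}\}$ (so it is $0$ if $\mathcal{R}\setminus\{0\}$ is empty). *)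

theory Defs
  imports "HOL-Analysis.Analysis"
begin

text \<open>A geodesic is parametrised on \<open>[0,1]\<close> proportionally to arc length; its values outside
  \<open>[0,1]\<close> are irrelevant. Constant maps are geodesics.\<close>

definition (in metric_space) geodesic :: "(real \<Rightarrow> 'a) \<Rightarrow> bool" where
  "geodesic \<gamma> \<longleftrightarrow>
     (\<forall>s\<in>{0..1}. \<forall>t\<in>{0..1}. dist (\<gamma> s) (\<gamma> t) = \<bar>s - t\<bar> * dist (\<gamma> 0) (\<gamma> 1))"

text \<open>In \<open>CAT0\<close>, \<open>p\<close>, \<open>q\<close>, \<open>r\<close> are the vertices of a Euclidean comparison triangle for the geodesic
  triangle with sides \<open>\<alpha>\<close> (from \<open>\<alpha> 0\<close> to \<open>\<alpha> 1\<close>), \<open>\<beta>\<close> (from \<open>\<beta> 0 = \<alpha> 0\<close> to \<open>\<beta> 1\<close>) and \<open>\<gamma>\<close> (from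
  \<open>\<alpha> 1\<close> to \<open>\<beta> 1\<close>). It suffices to compare points on the two sides issuing from \<open>\<alpha> 0\<close>: any two
  sides share a vertex, and sides may be relabelled and reversed.\<close>

class hadamard_space = complete_space +
  assumes ex_geodesic: "\<exists>\<gamma>. geodesic \<gamma> \<and> \<gamma> 0 = x \<and> \<gamma> 1 = y"
  assumes CAT0:
    "\<And>(p :: real ^ 2) q r.
       \<lbrakk>geodesic \<alpha>; geodesic \<beta>; geodesic \<gamma>; \<alpha> 0 = \<beta> 0; \<gamma> 0 = \<alpha> 1; \<gamma> 1 = \<beta> 1;
        norm (p - q) = dist (\<alpha> 0) (\<alpha> 1); norm (p - r) = dist (\<beta> 0) (\<beta> 1);
        norm (q - r) = dist (\<gamma> 0) (\<gamma> 1); 0 \<le> s; s \<le> 1; 0 \<le> t; t \<le> 1\<rbrakk>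
       \<Longrightarrow> dist (\<alpha> s) (\<beta> t)
            \<le> norm (((1 - s) *\<^sub>R p + s *\<^sub>R q) - ((1 - t) *\<^sub>R p + t *\<^sub>R r))"

definition weakly_converges :: "(nat \<Rightarrow> 'a::metric_space) \<Rightarrow> 'a \<Rightarrow> bool" where
  "weakly_converges x l \<longleftrightarrow> bounded (range x) \<and>
     (\<forall>r :: nat \<Rightarrow> nat. strict_mono r \<longrightarrow>
        (\<forall>y. is_arg_min (\<lambda>z. limsup (\<lambda>k. ereal (dist z (x (r k))))) (\<lambda>_. True) y
               \<longleftrightarrow> y = l))"

definition compatible_topology :: "'a::metric_space topology \<Rightarrow> bool" where
  "compatible_topology \<sigma> \<longleftrightarrow> topspace \<sigma> = UNIV \<and>
     Hausdorff_space \<sigma> \<and>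
     (\<forall>U. openin \<sigma> U \<longrightarrow> open U) \<and>
     (\<forall>x l. bounded (range x) \<and> limitin \<sigma> x l sequentially \<longrightarrow> weakly_converges x l) \<and>
     (\<forall>x y l m. bounded (range x) \<and> bounded (range y) \<and>
        limitin \<sigma> x l sequentially \<and> limitin \<sigma> y m sequentially \<longrightarrow>
        ereal (dist l m) \<le> liminf (\<lambda>j. ereal (dist (x j) (y j)))) \<and>
     (\<forall>(\<gamma> :: nat \<Rightarrow> real \<Rightarrow> 'a) \<delta>. (\<forall>j. geodesic (\<gamma> j)) \<and> geodesic \<delta> \<and>
        limitin \<sigma> (\<lambda>j. \<gamma> j 0) (\<delta> 0) sequentially \<and>
        limitin \<sigma> (\<lambda>j. \<gamma> j 1) (\<delta> 1) sequentially \<longrightarrow>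
        (\<forall>t\<in>{0..1}. limitin \<sigma> (\<lambda>j. \<gamma> j t) (\<delta> t) sequentially))"

definition sequentially_compactin :: "'a topology \<Rightarrow> 'a set \<Rightarrow> bool" where
  "sequentially_compactin \<sigma> K \<longleftrightarrow>
     (\<forall>x :: nat \<Rightarrow> 'a. (\<forall>j. x j \<in> K) \<longrightarrow>
        (\<exists>l\<in>K. \<exists>r :: nat \<Rightarrow> nat. strict_mono r \<and> limitin \<sigma> (x \<circ> r) l sequentially))"

text \<open>Functions to \<open>(-\<infinity>,\<infinity>]\<close> are \<open>ereal\<close>-valued functions avoiding \<open>-\<infinity>\<close>.\<close>

definition Dom :: "('a \<Rightarrow> ereal) \<Rightarrow> 'a set" where
  "Dom F = F -` range ereal"

definition geodesically_convex :: "('a::metric_space \<Rightarrow> ereal) \<Rightarrow> bool" where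
  "geodesically_convex F \<longleftrightarrow> (\<forall>\<gamma>. geodesic \<gamma> \<longrightarrow>
     (\<forall>t\<in>{0..1}. F (\<gamma> t) \<le> ereal (1 - t) * F (\<gamma> 0) + ereal t * F (\<gamma> 1)))"

definition lower_semicontinuous :: "('a::topological_space \<Rightarrow> ereal) \<Rightarrow> bool" where
  "lower_semicontinuous F \<longleftrightarrow> (\<forall>x. F x \<le> Liminf (at x) F)"

text \<open>The outer \<open>max\<close> only matters at isolated points \<open>y\<close>, where \<open>at y\<close> is the trivial filter with
  \<open>Limsup = -\<infinity>\<close>: the slope of a function that is finite at an isolated point is \<open>0\<close> there.\<close>

definition slope :: "('a::metric_space \<Rightarrow> ereal) \<Rightarrow> 'a \<Rightarrow> ereal" where
  "slope F y =
     (if y \<in> Dom F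
      then max 0 (Limsup (at y) (\<lambda>z. max (F y - F z) 0 / ereal (dist y z)))
      else \<infinity>)"

definition resolvent :: "('a::metric_space \<Rightarrow> ereal) \<Rightarrow> real \<Rightarrow> 'a \<Rightarrow> 'a" where
  "resolvent F \<tau> u = arg_min (\<lambda>v. ereal (1 / 2 * (dist u v)\<^sup>2) + ereal \<tau> * F v) (\<lambda>_. True)"

text \<open>For \<open>t = 0\<close>, since \<open>0 * \<infinity> = 0\<close> in \<open>ereal\<close>, \<open>resolvent F 0\<close> is the identity and the flow is at
  its starting point.\<close>

definition gradient_flow :: "('a::metric_space \<Rightarrow> ereal) \<Rightarrow> 'a \<Rightarrow> real \<Rightarrow> 'a" where
  "gradient_flow F c t = lim (\<lambda>m. (resolvent F (t / real m) ^^ m) c)"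

text \<open>Rays are \<open>extensional\<close> on \<open>[0,\<infinity>)\<close>, so that equality of rays is equality on \<open>[0,\<infinity>)\<close>.\<close>

definition rays :: "'a::metric_space \<Rightarrow> (real \<Rightarrow> 'a) set" where
  "rays x\<^sub>0 = {l \<in> extensional {0..}. l 0 = x\<^sub>0 \<and>
     (\<exists>c\<ge>0. \<forall>s\<ge>0. \<forall>t\<ge>0. dist (l s) (l t) = c * \<bar>s - t\<bar>)}"

definition constant_ray :: "'a \<Rightarrow> real \<Rightarrow> 'a" where
  "constant_ray x\<^sub>0 = (\<lambda>t\<in>{0..}. x\<^sub>0)"

definition ray_norm :: "(real \<Rightarrow> 'a::metric_space) \<Rightarrow> real" where
  "ray_norm l = dist (l 0) (l 1)"

definition radial :: "('a \<Rightarrow> ereal) \<Rightarrow> (real \<Rightarrow> 'a) \<Rightarrow> ereal" where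
  "radial F l = Lim at_top (\<lambda>t. F (l t) / ereal t)"

definition is_maximum :: "'a::order set \<Rightarrow> 'a \<Rightarrow> bool" where
  "is_maximum S m \<longleftrightarrow> m \<in> S \<and> (\<forall>s\<in>S. s \<le> m)"

end

theory Submission
  imports Defs "HOL-Library.Diagonal_Subsequence"
begin

text \<open>
  Why the theorem is true. Let \<open>s\<close> be the infimum of the slope.

  No ray beats \<open>s\<close>. By convexity, the slope bounds difference quotients globally:
  \<open>F x - F z \<le> \<bar>\<partial>F\<bar>(x) d(x,z)\<close> for every \<open>z\<close> (\<open>le_slope_mult_dist\<close>). Letting \<open>z\<close> run to infinity along
  a ray of speed \<open>c\<close> and dividing by time gives \<open>- radial F l \<le> c \<bar>\<partial>F\<bar>(x)\<close>
  (\<open>minus_radial_le_slope\<close>).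

  If \<open>s > 0\<close>, the gradient flow produces an optimal ray. A resolvent step from \<open>u\<close> to
  \<open>v = J\<^sub>\<tau> u\<close> lowers \<open>F\<close> by at least \<open>d(u,v)\<^sup>2/\<tau>\<close>, and \<open>d(u,v)/\<tau>\<close> is at least the slope at \<open>v\<close>, hence
  at least \<open>s\<close>. So each step lowers \<open>F\<close> by at least \<open>s d(u,v)\<close> and by at least \<open>s\<^sup>2\<tau>\<close>. Summing over the
  steps and passing to the limit, the flow \<open>y\<^sub>t\<close> from \<open>x\<^sub>0\<close> satisfies
  \<open>F y\<^sub>t \<le> F x\<^sub>0 - s d(x\<^sub>0,y\<^sub>t)\<close> and \<open>F y\<^sub>t \<le> F x\<^sub>0 - s\<^sup>2 t\<close> (\<open>gradient_flow_decrease\<close>). Since \<open>F\<close> is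
  bounded below by an affine function of the distance (\<open>linear_lower_bound\<close>), \<open>y\<^sub>t\<close> runs to infinity.
  By convexity, on the geodesic from \<open>x\<^sub>0\<close> to \<open>y\<^sub>t\<close>, the point at distance \<open>r\<close> from \<open>x\<^sub>0\<close> has
  \<open>F \<le> F x\<^sub>0 - s r\<close>, and \<open>G \<le> G x\<^sub>0\<close> because \<open>G\<close> decreases along the flow. The compactness assumption
  therefore applies to these geodesics, and a diagonal sequence of them converges to a ray \<open>l\<close>
  (\<open>limit_ray\<close>), whose speed \<open>c\<close> can drop in the limit but is at most \<open>1\<close>. As \<open>F\<close> is weakly lower
  semicontinuous (\<open>weak_limit_le\<close>), \<open>F (l r) \<le> F x\<^sub>0 - s r\<close>. So \<open>- radial F l \<ge> s\<close>, which excludes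
  \<open>c = 0\<close>, and \<open>- radial F l / c \<ge> s / c \<ge> s\<close>; by the first part this is an equality.

  What remains is that the flow exists, that is, that the iterated resolvents converge. This is the
  Crandall-Liggett estimate, which in a Hadamard space rests on two facts: resolvents are
  nonexpansive (\<open>resolvent_nonexpansive\<close>, by the quadrilateral inequality) and a resolvent with a
  long step is a resolvent with a short step started further along
  (\<open>resolvent_on_geodesic\<close>).
\<close>

section \<open>Metric inequalities in Hadamard spaces\<close>

lemma geodesic_dist:
  assumes "geodesic \<gamma>" "s \<in> {0..1}" "t \<in> {0..1}"
  shows "dist (\<gamma> s) (\<gamma> t) = \<bar>s - t\<bar> * dist (\<gamma> 0) (\<gamma> 1)"
  using assms unfolding geodesic_def by blast

lemma geodesic_initial_segment:
  assumes "geodesic \<gamma>" "k \<in> {0..1}"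
  shows "geodesic (\<lambda>s. \<gamma> (s * k))"
  unfolding geodesic_def
proof (intro ballI)
  fix s t :: real assume st: "s \<in> {0..1}" "t \<in> {0..1}"
  have m: "u * k \<in> {0..1}" if "u \<in> {0..1}" for u
    using that assms(2) by (auto intro: mult_le_one)
  have "dist (\<gamma> (s * k)) (\<gamma> (t * k)) = \<bar>s * k - t * k\<bar> * dist (\<gamma> 0) (\<gamma> 1)"
    by (intro geodesic_dist assms m st)
  moreover have "dist (\<gamma> (0 * k)) (\<gamma> (1 * k)) = \<bar>0 * k - 1 * k\<bar> * dist (\<gamma> 0) (\<gamma> 1)"
    by (intro geodesic_dist assms m) auto
  moreover have "\<bar>s * k - t * k\<bar> = \<bar>s - t\<bar> * k"
    using assms(2) by (simp add: left_diff_distrib[symmetric] abs_mult)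
  ultimately show "dist (\<gamma> (s * k)) (\<gamma> (t * k)) = \<bar>s - t\<bar> * dist (\<gamma> (0 * k)) (\<gamma> (1 * k))"
    using assms(2) by (simp add: mult.assoc)
qed

lemma comparison_triangle_exists:
  fixes a b c :: real
  assumes "a > 0" "b \<ge> 0" "c \<ge> 0" "a \<le> b + c" "b \<le> a + c" "c \<le> a + b"
  shows "\<exists>p q r :: real ^ 2. norm (p - q) = a \<and> norm (p - r) = b \<and> norm (q - r) = c"
proof -
  \<comment> \<open>The law of cosines: \<open>h\<close> is the first coordinate of the vertex \<open>r\<close>.\<close>
  define h where "h = (a\<^sup>2 + b\<^sup>2 - c\<^sup>2) / (2 * a)"
  have h: "2 * a * h = a\<^sup>2 + b\<^sup>2 - c\<^sup>2"
    using assms(1) by (simp add: h_def)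
  have "(2 * a * h)\<^sup>2 \<le> (2 * a * b)\<^sup>2"
  proof (rule power2_le_iff_abs_le[THEN iffD2])
    show "0 \<le> 2 * a * b" using assms by simp
    have "c\<^sup>2 \<le> (a + b)\<^sup>2" using assms by (intro power_mono) auto
    moreover have "(a - b)\<^sup>2 \<le> c\<^sup>2" using assms by (intro power2_le_iff_abs_le[THEN iffD2]) auto
    ultimately show "\<bar>2 * a * h\<bar> \<le> 2 * a * b"
      unfolding h by (simp add: power2_eq_square algebra_simps abs_le_iff)
  qed
  then have hb: "h\<^sup>2 \<le> b\<^sup>2"
    using assms(1) by (simp add: power_mult_distrib)
  have "norm (vector [0, 0] - vector [a, 0] :: real ^ 2) = a"
    using assms(1) by (simp add: norm_vec_def L2_set_def sum_2)
  moreover have "norm (vector [0, 0] - vector [h, sqrt (b\<^sup>2 - h\<^sup>2)] :: real ^ 2) = b"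
    using assms hb by (simp add: norm_vec_def L2_set_def sum_2)
  moreover have "norm (vector [a, 0] - vector [h, sqrt (b\<^sup>2 - h\<^sup>2)] :: real ^ 2) = c"
  proof -
    have "(a - h)\<^sup>2 + (b\<^sup>2 - h\<^sup>2) = c\<^sup>2"
      using h by (simp add: power2_eq_square algebra_simps)
    then show ?thesis
      using assms hb by (simp add: norm_vec_def L2_set_def sum_2)
  qed
  ultimately show ?thesis by blast
qed

lemma norm_convex_combination_diff:
  fixes p q r :: "'b::real_inner"
  shows "(norm (((1 - t) *\<^sub>R p + t *\<^sub>R q) - r))\<^sup>2
    = (1 - t) * (norm (p - r))\<^sup>2 + t * (norm (q - r))\<^sup>2 - t * (1 - t) * (norm (p - q))\<^sup>2"
  by (simp add: power2_norm_eq_inner inner_diff_left inner_diff_right inner_add_left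
      inner_add_right inner_commute algebra_simps)

text \<open>The squared distance to a point is \<open>2\<close>-strongly convex. In the Euclidean plane this is the
  identity \<open>norm_convex_combination_diff\<close>; comparison turns it into an inequality.\<close>

lemma geodesic_dist_power2_le:
  fixes z :: "'a::hadamard_space"
  assumes \<gamma>: "geodesic \<gamma>" and t: "t \<in> {0..1}"
  shows "(dist (\<gamma> t) z)\<^sup>2 \<le> (1 - t) * (dist (\<gamma> 0) z)\<^sup>2 + t * (dist (\<gamma> 1) z)\<^sup>2
    - t * (1 - t) * (dist (\<gamma> 0) (\<gamma> 1))\<^sup>2"
proof (cases "\<gamma> 0 = \<gamma> 1")
  case True
  then have "\<gamma> t = \<gamma> 0"
    using geodesic_dist[OF \<gamma> t, of 0] by simp
  then show ?thesis
    using True by (simp add: algebra_simps)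
next
  case False
  obtain \<beta> where \<beta>: "geodesic \<beta>" "\<beta> 0 = \<gamma> 0" "\<beta> 1 = z" using ex_geodesic by blast
  obtain \<delta> where \<delta>: "geodesic \<delta>" "\<delta> 0 = \<gamma> 1" "\<delta> 1 = z" using ex_geodesic by blast
  obtain p q r :: "real ^ 2" where pqr: "norm (p - q) = dist (\<gamma> 0) (\<gamma> 1)"
    "norm (p - r) = dist (\<gamma> 0) z" "norm (q - r) = dist (\<gamma> 1) z"
    using comparison_triangle_exists[of "dist (\<gamma> 0) (\<gamma> 1)" "dist (\<gamma> 0) z" "dist (\<gamma> 1) z"] False
    by (metis dist_commute dist_triangle dist_triangle2 dist_triangle3 zero_le_dist zero_less_dist_iff)
  have "dist (\<gamma> t) (\<beta> 1) \<le> norm (((1 - t) *\<^sub>R p + t *\<^sub>R q) - ((1 - 1) *\<^sub>R p + 1 *\<^sub>R r))"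
    using \<gamma> \<beta> \<delta> pqr t by (intro CAT0[of \<gamma> \<beta> \<delta>]) auto
  then have "(dist (\<gamma> t) z)\<^sup>2 \<le> (norm (((1 - t) *\<^sub>R p + t *\<^sub>R q) - r))\<^sup>2"
    using \<beta> by (intro power_mono) auto
  then show ?thesis
    by (simp add: norm_convex_combination_diff pqr)
qed

lemma sum_power2_le_weighted:
  fixes a b t :: real
  assumes "0 < t" "t < 1"
  shows "(a + b)\<^sup>2 \<le> a\<^sup>2 / t + b\<^sup>2 / (1 - t)"
proof -
  have "a\<^sup>2 / t + b\<^sup>2 / (1 - t) - (a + b)\<^sup>2 = ((1 - t) * a - t * b)\<^sup>2 / (t * (1 - t))"
    using assms by (simp add: field_simps power2_eq_square)
  also have "\<dots> \<ge> 0" using assms by simp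
  finally show ?thesis by simp
qed

lemma geodesic_dist_le:
  fixes z :: "'a::hadamard_space"
  assumes \<gamma>: "geodesic \<gamma>" and t: "t \<in> {0..1}"
  shows "dist (\<gamma> t) z \<le> (1 - t) * dist (\<gamma> 0) z + t * dist (\<gamma> 1) z"
proof (rule power2_le_imp_le)
  let ?a = "dist (\<gamma> 0) z" and ?b = "dist (\<gamma> 1) z" and ?c = "dist (\<gamma> 0) (\<gamma> 1)"
  have "(?a - ?b)\<^sup>2 \<le> ?c\<^sup>2"
    by (intro power2_le_iff_abs_le[THEN iffD2])
      (auto simp: abs_le_iff, metis dist_commute dist_triangle add.commute diff_le_eq,
        metis dist_commute dist_triangle add.commute diff_le_eq)
  then have "t * (1 - t) * (?a - ?b)\<^sup>2 \<le> t * (1 - t) * ?c\<^sup>2"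
    using t by (intro mult_left_mono) auto
  moreover have "((1 - t) * ?a + t * ?b)\<^sup>2 = (1 - t) * ?a\<^sup>2 + t * ?b\<^sup>2 - t * (1 - t) * (?a - ?b)\<^sup>2"
    by (simp add: power2_eq_square algebra_simps)
  ultimately show "(dist (\<gamma> t) z)\<^sup>2 \<le> ((1 - t) * ?a + t * ?b)\<^sup>2"
    using geodesic_dist_power2_le[OF \<gamma> t, of z] by linarith
  show "0 \<le> (1 - t) * ?a + t * ?b" using t by simp
qed

text \<open>The diagonal \<open>d(x,v)\<close> is estimated through the point at parameter \<open>t\<close> of the geodesic from \<open>y\<close>
  to \<open>u\<close>. Splitting the square of the sum with the weights \<open>t\<close> and \<open>1 - t\<close>
  makes the coefficients of \<open>d(x,u)\<^sup>2\<close>, \<open>d(y,v)\<^sup>2\<close> and \<open>d(y,u)\<^sup>2\<close> equal to \<open>1\<close>, \<open>1\<close> and \<open>-1\<close> for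
  every \<open>t\<close>; what is left is \<open>(1-t)/t d(x,y)\<^sup>2 + t/(1-t) d(u,v)\<^sup>2\<close>, which is smallest at the \<open>t\<close>
  chosen below.\<close>

lemma quadrilateral_inequality:
  fixes x y u v :: "'a::hadamard_space"
  shows "(dist x v)\<^sup>2 + (dist y u)\<^sup>2 \<le> (dist x u)\<^sup>2 + (dist y v)\<^sup>2 + 2 * dist x y * dist u v"
proof (cases "x = y \<or> u = v")
  case True
  then show ?thesis by auto
next
  case False
  define a b t where "a = dist x y" and "b = dist u v" and "t = a / (a + b)"
  have ab: "a > 0" "b > 0" using False by (auto simp: a_def b_def)
  then have t: "0 < t" "t < 1" by (auto simp: t_def)
  have t': "1 - t = b / (a + b)"
    using ab by (simp add: t_def field_simps)
  obtain \<gamma> where \<gamma>: "geodesic \<gamma>" "\<gamma> 0 = y" "\<gamma> 1 = u" using ex_geodesic by blast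
  define w where "w = \<gamma> t"
  have wx: "(dist w x)\<^sup>2 \<le> (1 - t) * a\<^sup>2 + t * (dist x u)\<^sup>2 - t * (1 - t) * (dist y u)\<^sup>2"
    using geodesic_dist_power2_le[OF \<gamma>(1), of t x] t \<gamma> by (simp add: w_def a_def dist_commute)
  have wv: "(dist w v)\<^sup>2 \<le> (1 - t) * (dist y v)\<^sup>2 + t * b\<^sup>2 - t * (1 - t) * (dist y u)\<^sup>2"
    using geodesic_dist_power2_le[OF \<gamma>(1), of t v] t \<gamma> by (simp add: w_def b_def)
  have "(dist x v)\<^sup>2 \<le> (dist w x + dist w v)\<^sup>2"
    by (intro power_mono) (auto simp: dist_triangle3 dist_triangle)
  also have "\<dots> \<le> (dist w x)\<^sup>2 / t + (dist w v)\<^sup>2 / (1 - t)"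
    by (rule sum_power2_le_weighted[OF t])
  also have "\<dots> \<le> ((1 - t) * a\<^sup>2 + t * (dist x u)\<^sup>2 - t * (1 - t) * (dist y u)\<^sup>2) / t
      + ((1 - t) * (dist y v)\<^sup>2 + t * b\<^sup>2 - t * (1 - t) * (dist y u)\<^sup>2) / (1 - t)"
    using t by (intro add_mono divide_right_mono wx wv) auto
  also have "\<dots> = (dist x u)\<^sup>2 + (dist y v)\<^sup>2 - (dist y u)\<^sup>2 + ((1 - t) / t * a\<^sup>2 + t / (1 - t) * b\<^sup>2)"
    using t by (simp add: field_simps)
  also have "(1 - t) / t = b / a"
    using ab by (simp add: t') (simp add: t_def)
  also have "t / (1 - t) = a / b"
    using ab by (simp add: t') (simp add: t_def)
  also have "b / a * a\<^sup>2 + a / b * b\<^sup>2 = 2 * a * b"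
    using ab by (simp add: field_simps power2_eq_square)
  finally show ?thesis by (simp add: a_def b_def)
qed

section \<open>Convex lower semicontinuous functions\<close>

lemma eventually_gt_of_lower_semicontinuous:
  fixes F :: "'a::t2_space \<Rightarrow> ereal"
  assumes "lower_semicontinuous F" "b < F x"
  shows "eventually (\<lambda>y. b < F y) (nhds x)"
proof -
  have "b < Liminf (at x) F"
    using assms unfolding lower_semicontinuous_def by (meson less_le_trans)
  then have "eventually (\<lambda>y. b < F y) (at x)"
    by (rule less_LiminfD)
  then have "eventually (\<lambda>y. y \<noteq> x \<longrightarrow> b < F y) (nhds x)"
    by (simp add: eventually_at_filter)
  then show ?thesis
    by (rule eventually_mono) (use assms in auto)
qed

lemma closed_sublevel_of_lower_semicontinuous:
  fixes F :: "'a::t2_space \<Rightarrow> ereal"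
  assumes "lower_semicontinuous F"
  shows "closed {x. F x \<le> b}"
proof -
  have "open {x. b < F x}"
    using eventually_gt_of_lower_semicontinuous[OF assms]
    by (subst open_subopen) (fastforce simp: eventually_nhds)
  then show ?thesis
    by (simp add: closed_def Collect_neg_eq[symmetric] not_le)
qed

lemma lower_semicontinuous_limit_le:
  fixes F :: "'a::t2_space \<Rightarrow> ereal" and X :: "nat \<Rightarrow> 'a"
  assumes "lower_semicontinuous F" "X \<longlonglongrightarrow> x" "eventually (\<lambda>n. F (X n) \<le> b) sequentially"
  shows "F x \<le> b"
  using Lim_in_closed_set[OF closed_sublevel_of_lower_semicontinuous[OF assms(1), of b], of X sequentially x]
    assms by simp

lemma quadratic_minus_linear_ge:
  fixes a k :: real
  shows "- k\<^sup>2 / 2 \<le> a\<^sup>2 / 2 - k * a"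
  using zero_le_power2[of "a - k"] by (simp add: power2_eq_square algebra_simps)

locale convex_lsc_function =
  fixes F :: "'a::hadamard_space \<Rightarrow> ereal"
  assumes not_MInfty: "F x \<noteq> -\<infinity>"
    and convex: "geodesically_convex F"
    and lsc: "lower_semicontinuous F"
    and Dom_nonempty: "Dom F \<noteq> {}"
begin

definition f :: "'a \<Rightarrow> real" where "f x = real_of_ereal (F x)"

lemma F_eq: "x \<in> Dom F \<Longrightarrow> F x = ereal (f x)"
  using not_MInfty[of x] by (cases "F x") (auto simp: Dom_def f_def)

lemma in_Dom_if_le: "F x \<le> ereal b \<Longrightarrow> x \<in> Dom F"
  using not_MInfty[of x] by (cases "F x") (auto simp: Dom_def)

lemma F_eq_PInfty: "x \<notin> Dom F \<Longrightarrow> F x = \<infinity>"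
  using not_MInfty[of x] by (cases "F x") (auto simp: Dom_def)

lemma f_le_iff: "x \<in> Dom F \<Longrightarrow> F x \<le> ereal b \<longleftrightarrow> f x \<le> b"
  by (simp add: F_eq)

lemma
  assumes "geodesic \<gamma>" "\<gamma> 0 \<in> Dom F" "\<gamma> 1 \<in> Dom F" "t \<in> {0..1}"
  shows geodesic_in_Dom: "\<gamma> t \<in> Dom F"
    and f_geodesic_le: "f (\<gamma> t) \<le> (1 - t) * f (\<gamma> 0) + t * f (\<gamma> 1)"
proof -
  have "F (\<gamma> t) \<le> ereal (1 - t) * F (\<gamma> 0) + ereal t * F (\<gamma> 1)"
    using convex assms unfolding geodesically_convex_def by blast
  then have le: "F (\<gamma> t) \<le> ereal ((1 - t) * f (\<gamma> 0) + t * f (\<gamma> 1))"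
    using assms by (simp add: F_eq)
  show "\<gamma> t \<in> Dom F" by (rule in_Dom_if_le[OF le])
  then show "f (\<gamma> t) \<le> (1 - t) * f (\<gamma> 0) + t * f (\<gamma> 1)"
    using le by (simp add: f_le_iff)
qed

text \<open>By semicontinuity, \<open>F\<close> drops by at most \<open>1\<close> on a small ball around \<open>x\<^sub>0\<close>. A point further away
  cannot lie below the stated bound, since convexity would spread the drop along the geodesic and it
  would already exceed \<open>1\<close> on the boundary of the ball.\<close>

lemma linear_lower_bound:
  assumes "x\<^sub>0 \<in> Dom F"
  obtains r where "r > 0" "\<And>x. x \<in> Dom F \<Longrightarrow> f x\<^sub>0 - 1 - dist x\<^sub>0 x / r \<le> f x"
proof -
  have "eventually (\<lambda>y. ereal (f x\<^sub>0 - 1) < F y) (nhds x\<^sub>0)"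
    using assms by (intro eventually_gt_of_lower_semicontinuous[OF lsc]) (simp add: F_eq)
  then obtain e where e: "e > 0" "\<And>y. dist y x\<^sub>0 < e \<Longrightarrow> ereal (f x\<^sub>0 - 1) < F y"
    by (auto simp: eventually_nhds_metric)
  define r where "r = e / 2"
  have r: "r > 0" "r < e" using e by (auto simp: r_def)
  have "f x\<^sub>0 - 1 - dist x\<^sub>0 x / r \<le> f x" if x: "x \<in> Dom F" for x
  proof (cases "dist x\<^sub>0 x \<le> r")
    case True
    then have "f x\<^sub>0 - 1 < f x"
      using e(2)[of x] r x by (simp add: F_eq dist_commute)
    moreover have "0 \<le> dist x\<^sub>0 x / r" using r by simp
    ultimately show ?thesis by linarith
  next
    case False
    define d where "d = dist x\<^sub>0 x"
    have d: "d > r" "d > 0" using False r by (auto simp: d_def)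
    define t where "t = r / d"
    have t: "t \<in> {0..1}" "t > 0" using d r by (auto simp: t_def)
    obtain \<gamma> where \<gamma>: "geodesic \<gamma>" "\<gamma> 0 = x\<^sub>0" "\<gamma> 1 = x" using ex_geodesic by blast
    have "dist (\<gamma> t) x\<^sub>0 = r"
      using geodesic_dist[OF \<gamma>(1) t(1), of 0] \<gamma> d r by (simp add: t_def d_def)
    then have "f x\<^sub>0 - 1 < f (\<gamma> t)"
      using e(2)[of "\<gamma> t"] r geodesic_in_Dom[OF \<gamma>(1)] \<gamma> assms x t by (simp add: F_eq)
    also have "\<dots> \<le> (1 - t) * f x\<^sub>0 + t * f x"
      using f_geodesic_le[OF \<gamma>(1), of t] \<gamma> assms x t by simp
    finally have "- 1 < t * (f x - f x\<^sub>0)"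
      by (simp add: algebra_simps)
    then have "- 1 / t < f x - f x\<^sub>0"
      using t by (simp add: field_simps)
    then show ?thesis
      by (simp add: t_def d_def)
  qed
  with r that show thesis by blast
qed

section \<open>Resolvents\<close>

definition prox_objective :: "real \<Rightarrow> 'a \<Rightarrow> 'a \<Rightarrow> real" where
  "prox_objective \<tau> u v = (dist u v)\<^sup>2 / 2 + \<tau> * f v"

lemma prox_objective_geodesic_le:
  assumes "\<tau> \<ge> 0" "geodesic \<gamma>" "\<gamma> 0 \<in> Dom F" "\<gamma> 1 \<in> Dom F" "t \<in> {0..1}"
  shows "prox_objective \<tau> u (\<gamma> t) \<le> (1 - t) * prox_objective \<tau> u (\<gamma> 0) + t * prox_objective \<tau> u (\<gamma> 1)
    - t * (1 - t) * (dist (\<gamma> 0) (\<gamma> 1))\<^sup>2 / 2"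
proof -
  have "\<tau> * f (\<gamma> t) \<le> \<tau> * ((1 - t) * f (\<gamma> 0) + t * f (\<gamma> 1))"
    using assms by (intro mult_left_mono f_geodesic_le) auto
  moreover have "(dist u (\<gamma> t))\<^sup>2 \<le> (1 - t) * (dist u (\<gamma> 0))\<^sup>2 + t * (dist u (\<gamma> 1))\<^sup>2
    - t * (1 - t) * (dist (\<gamma> 0) (\<gamma> 1))\<^sup>2"
    using geodesic_dist_power2_le[OF assms(2,5), of u] by (simp add: dist_commute)
  ultimately show ?thesis
    by (simp add: prox_objective_def field_simps)
qed

lemma prox_objective_bdd_below:
  assumes "\<tau> > 0"
  shows "bdd_below (prox_objective \<tau> u ` Dom F)"
proof -
  obtain x\<^sub>0 where x\<^sub>0: "x\<^sub>0 \<in> Dom F" using Dom_nonempty by blast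
  obtain r where r: "r > 0" "\<And>x. x \<in> Dom F \<Longrightarrow> f x\<^sub>0 - 1 - dist x\<^sub>0 x / r \<le> f x"
    using linear_lower_bound[OF x\<^sub>0] by blast
  have "- (\<tau> / r)\<^sup>2 / 2 + \<tau> * (f x\<^sub>0 - 1 - dist x\<^sub>0 u / r) \<le> prox_objective \<tau> u v" if v: "v \<in> Dom F" for v
  proof -
    have "dist x\<^sub>0 v / r \<le> (dist x\<^sub>0 u + dist u v) / r"
      using r by (intro divide_right_mono dist_triangle) auto
    then have "f x\<^sub>0 - 1 - (dist x\<^sub>0 u + dist u v) / r \<le> f v"
      using r(2)[OF v] by linarith
    then have "\<tau> * (f x\<^sub>0 - 1 - (dist x\<^sub>0 u + dist u v) / r) \<le> \<tau> * f v"
      using assms by (intro mult_left_mono) auto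
    moreover have "\<tau> * (f x\<^sub>0 - 1 - (dist x\<^sub>0 u + dist u v) / r)
        = \<tau> * (f x\<^sub>0 - 1 - dist x\<^sub>0 u / r) - \<tau> / r * dist u v"
      by (simp add: algebra_simps add_divide_distrib)
    ultimately show ?thesis
      using quadratic_minus_linear_ge[of "\<tau> / r" "dist u v"] unfolding prox_objective_def by linarith
  qed
  then show ?thesis by (meson bdd_belowI2)
qed

text \<open>Strong convexity makes every minimizing sequence Cauchy, because the midpoint of two almost
  minimizers would otherwise be too low. It also gives the quadratic growth around the minimizer, by
  comparing the minimum with the values near it on the geodesic to the competitor.\<close>

lemma prox_objective_minimizer_exists:
  assumes \<tau>: "\<tau> > 0"
  obtains y where "y \<in> Dom F" "\<And>v. v \<in> Dom F \<Longrightarrow> prox_objective \<tau> u y + (dist y v)\<^sup>2 / 2 \<le> prox_objective \<tau> u v"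
proof -
  define m where "m = (INF v\<in>Dom F. prox_objective \<tau> u v)"
  have m_le: "m \<le> prox_objective \<tau> u v" if "v \<in> Dom F" for v
    unfolding m_def by (rule cINF_lower[OF prox_objective_bdd_below[OF \<tau>] that])
  have "\<exists>v\<in>Dom F. prox_objective \<tau> u v < m + e" if "e > 0" for e
    using cINF_less_iff[OF Dom_nonempty prox_objective_bdd_below[OF \<tau>], of u "m + e"] that
    by (simp add: m_def)
  then have "\<exists>v\<in>Dom F. prox_objective \<tau> u v < m + 1 / real (Suc n)" for n by simp
  then obtain v where v: "\<And>n. v n \<in> Dom F" "\<And>n. prox_objective \<tau> u (v n) < m + 1 / real (Suc n)"
    by metis
  have close: "(dist a b)\<^sup>2 \<le> 4 * ((prox_objective \<tau> u a - m) + (prox_objective \<tau> u b - m))"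
    if ab: "a \<in> Dom F" "b \<in> Dom F" for a b
  proof -
    obtain \<gamma> where \<gamma>: "geodesic \<gamma>" "\<gamma> 0 = a" "\<gamma> 1 = b" using ex_geodesic by blast
    have "m \<le> prox_objective \<tau> u (\<gamma> (1/2))"
      using geodesic_in_Dom[OF \<gamma>(1), of "1/2"] \<gamma> ab by (intro m_le) auto
    also have "\<dots> \<le> prox_objective \<tau> u a / 2 + prox_objective \<tau> u b / 2 - (dist a b)\<^sup>2 / 8"
      using prox_objective_geodesic_le[of \<tau> \<gamma> "1/2" u] \<gamma> ab \<tau> by simp
    finally show ?thesis by (simp add: field_simps)
  qed
  have "Cauchy v"
  proof (rule metric_CauchyI)
    fix e :: real assume e: "e > 0"
    then obtain N where N: "8 / e\<^sup>2 < real N" using reals_Archimedean2 by blast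
    have "8 < e\<^sup>2 * real N" using N e by (simp add: field_simps)
    then have N8: "8 / real (Suc N) < e\<^sup>2"
      using e by (simp add: field_simps) (smt (verit) zero_le_power2)
    show "\<exists>M. \<forall>i\<ge>M. \<forall>j\<ge>M. dist (v i) (v j) < e"
    proof (intro exI[of _ N] allI impI)
      fix i j assume ij: "N \<le> i" "N \<le> j"
      have "prox_objective \<tau> u (v k) - m \<le> 1 / real (Suc N)" if "N \<le> k" for k
      proof -
        have "1 / real (Suc k) \<le> 1 / real (Suc N)"
          using that by (intro divide_left_mono) auto
        then have "m + 1 / real (Suc k) \<le> m + 1 / real (Suc N)"
          by (rule add_left_mono)
        from less_le_trans[OF v(2) this] show ?thesis by (simp only: diff_le_eq less_imp_le add.commute)
      qed
      from this[OF ij(1)] this[OF ij(2)]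
      have "4 * ((prox_objective \<tau> u (v i) - m) + (prox_objective \<tau> u (v j) - m))
          \<le> 4 * (1 / real (Suc N) + 1 / real (Suc N))"
        by (intro mult_left_mono add_mono) auto
      with close[OF v(1)[of i] v(1)[of j]]
      have "(dist (v i) (v j))\<^sup>2 \<le> 4 * (1 / real (Suc N) + 1 / real (Suc N))"
        by (rule order.trans)
      also have "\<dots> < e\<^sup>2" using N8 by simp
      finally show "dist (v i) (v j) < e"
        using e by (simp add: power2_less_imp_less)
    qed
  qed
  then obtain y where y: "v \<longlonglongrightarrow> y"
    using Cauchy_convergent convergent_def by blast
  have F_y: "F y \<le> ereal ((m + e - (dist u y)\<^sup>2 / 2) / \<tau>)" if e: "e > 0" for e
  proof (rule lower_semicontinuous_limit_le[OF lsc y])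
    have "(\<lambda>n. m + 1 / real (Suc n) - (dist u (v n))\<^sup>2 / 2) \<longlonglongrightarrow> m + 0 - (dist u y)\<^sup>2 / 2"
      by (intro tendsto_intros y LIMSEQ_Suc[OF lim_1_over_n]) simp_all
    then have "eventually (\<lambda>n. m + 1 / real (Suc n) - (dist u (v n))\<^sup>2 / 2
        < m + e - (dist u y)\<^sup>2 / 2) sequentially"
      by (rule order_tendstoD) (use e in simp)
    then show "eventually (\<lambda>n. F (v n) \<le> ereal ((m + e - (dist u y)\<^sup>2 / 2) / \<tau>)) sequentially"
    proof (rule eventually_mono)
      fix n assume "m + 1 / real (Suc n) - (dist u (v n))\<^sup>2 / 2 < m + e - (dist u y)\<^sup>2 / 2"
      then have "\<tau> * f (v n) \<le> m + e - (dist u y)\<^sup>2 / 2"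
        using v(2)[of n] by (simp add: prox_objective_def)
      then show "F (v n) \<le> ereal ((m + e - (dist u y)\<^sup>2 / 2) / \<tau>)"
        using v(1) \<tau> by (simp add: f_le_iff field_simps)
    qed
  qed
  have yD: "y \<in> Dom F" using in_Dom_if_le[OF F_y[of 1]] by simp
  have "prox_objective \<tau> u y \<le> m + e" if "e > 0" for e
    using F_y[OF that] yD \<tau> by (simp add: f_le_iff prox_objective_def field_simps)
  then have ym: "prox_objective \<tau> u y \<le> m" by (rule field_le_epsilon)
  show thesis
  proof (rule that[OF yD])
    fix w assume w: "w \<in> Dom F"
    obtain \<gamma> where \<gamma>: "geodesic \<gamma>" "\<gamma> 0 = y" "\<gamma> 1 = w" using ex_geodesic by blast
    define k where "k = prox_objective \<tau> u y + (dist y w)\<^sup>2 / 2 - prox_objective \<tau> u w"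
    have k_le: "k \<le> t * ((dist y w)\<^sup>2 / 2)" if t: "0 < t" "t \<le> 1" for t
    proof -
      have "m \<le> prox_objective \<tau> u (\<gamma> t)"
        using geodesic_in_Dom[OF \<gamma>(1), of t] \<gamma> yD w t by (intro m_le) auto
      also have "\<dots> \<le> (1 - t) * prox_objective \<tau> u y + t * prox_objective \<tau> u w - t * (1 - t) * (dist y w)\<^sup>2 / 2"
        using prox_objective_geodesic_le[of \<tau> \<gamma> t u] \<gamma> yD w t \<tau> by simp
      finally have "0 \<le> (1 - t) * prox_objective \<tau> u y + t * prox_objective \<tau> u w
          - t * (1 - t) * (dist y w)\<^sup>2 / 2 - prox_objective \<tau> u y"
        using ym by linarith
      also have "\<dots> = t * (t * ((dist y w)\<^sup>2 / 2) - k)"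
        by (simp add: k_def field_simps)
      finally show ?thesis
        using t by (simp add: zero_le_mult_iff)
    qed
    have "((\<lambda>t. t * ((dist y w)\<^sup>2 / 2)) \<longlongrightarrow> 0 * ((dist y w)\<^sup>2 / 2)) (at_right 0)"
      by (intro tendsto_intros)
    then have "k \<le> 0 * ((dist y w)\<^sup>2 / 2)"
    proof (rule tendsto_lowerbound)
      show "eventually (\<lambda>t. k \<le> t * ((dist y w)\<^sup>2 / 2)) (at_right 0)"
        unfolding eventually_at_right_field using k_le by (auto intro!: exI[of _ 1])
    qed simp
    then show "prox_objective \<tau> u y + (dist y w)\<^sup>2 / 2 \<le> prox_objective \<tau> u w"
      by (simp add: k_def)
  qed
qed

lemma
  assumes \<tau>: "\<tau> > 0"
  shows resolvent_in_Dom: "resolvent F \<tau> u \<in> Dom F"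
    and prox_objective_resolvent_le: "v \<in> Dom F \<Longrightarrow>
      prox_objective \<tau> u (resolvent F \<tau> u) + (dist (resolvent F \<tau> u) v)\<^sup>2 / 2 \<le> prox_objective \<tau> u v"
proof -
  obtain y where y: "y \<in> Dom F"
    "\<And>v. v \<in> Dom F \<Longrightarrow> prox_objective \<tau> u y + (dist y v)\<^sup>2 / 2 \<le> prox_objective \<tau> u v"
    using prox_objective_minimizer_exists[OF \<tau>, of u] by blast
  let ?\<Phi> = "\<lambda>v. ereal (1 / 2 * (dist u v)\<^sup>2) + ereal \<tau> * F v"
  have \<Phi>: "?\<Phi> v = (if v \<in> Dom F then ereal (prox_objective \<tau> u v) else \<infinity>)" for v
    using \<tau> by (simp add: F_eq F_eq_PInfty prox_objective_def)
  have min: "is_arg_min ?\<Phi> (\<lambda>_. True) z \<longleftrightarrow> z = y" for z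
  proof
    assume z: "is_arg_min ?\<Phi> (\<lambda>_. True) z"
    then have "?\<Phi> z \<le> ?\<Phi> y" by (simp add: is_arg_min_linorder)
    then have zD: "z \<in> Dom F" and "prox_objective \<tau> u z \<le> prox_objective \<tau> u y"
      unfolding \<Phi> using y by (auto split: if_splits)
    with y(2)[OF zD] have "(dist y z)\<^sup>2 \<le> 0" by linarith
    then show "z = y" by simp
  next
    assume "z = y"
    moreover have "prox_objective \<tau> u y \<le> prox_objective \<tau> u v" if "v \<in> Dom F" for v
      using y(2)[OF that] zero_le_power2[of "dist y v"] by linarith
    ultimately show "is_arg_min ?\<Phi> (\<lambda>_. True) z"
      unfolding is_arg_min_linorder \<Phi> using y(1) by auto
  qed
  then have "resolvent F \<tau> u = y"
    unfolding resolvent_def arg_min_def by (intro some_equality) (auto simp only:)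
  with y show "resolvent F \<tau> u \<in> Dom F"
    "v \<in> Dom F \<Longrightarrow> prox_objective \<tau> u (resolvent F \<tau> u) + (dist (resolvent F \<tau> u) v)\<^sup>2 / 2 \<le> prox_objective \<tau> u v"
    by auto
qed

end

context convex_lsc_function
begin

lemma resolvent_descent:
  assumes "\<tau> > 0" "u \<in> Dom F"
  shows "(dist u (resolvent F \<tau> u))\<^sup>2 \<le> \<tau> * (f u - f (resolvent F \<tau> u))"
  using prox_objective_resolvent_le[OF assms, of u] by (simp add: prox_objective_def dist_commute algebra_simps)

text \<open>So a resolvent point has slope at most the distance moved divided by the time step.\<close>

lemma resolvent_descent_rate:
  assumes \<tau>: "\<tau> > 0" and v: "v \<in> Dom F"
  shows "f (resolvent F \<tau> u) - f v \<le> dist u (resolvent F \<tau> u) / \<tau> * dist (resolvent F \<tau> u) v"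
proof -
  let ?y = "resolvent F \<tau> u"
  have "(dist u v)\<^sup>2 \<le> (dist u ?y + dist ?y v)\<^sup>2"
    by (intro power_mono dist_triangle) auto
  then have "\<tau> * (f ?y - f v) \<le> dist u ?y * dist ?y v"
    using prox_objective_resolvent_le[OF \<tau> v, of u] by (simp add: prox_objective_def power2_eq_square algebra_simps)
  then show ?thesis using \<tau> by (simp add: field_simps)
qed

text \<open>Add the quadratic growth inequalities of the two minimizers, each tested at the other one: the
  values of \<open>F\<close> cancel, and the quadrilateral inequality bounds the cross distances that remain.\<close>

lemma resolvent_nonexpansive:
  assumes \<tau>: "\<tau> > 0"
  shows "dist (resolvent F \<tau> u) (resolvent F \<tau> u') \<le> dist u u'"
proof (cases "resolvent F \<tau> u = resolvent F \<tau> u'")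
  case False
  let ?y = "resolvent F \<tau> u" and ?y' = "resolvent F \<tau> u'"
  have "2 * (dist ?y ?y')\<^sup>2 + (dist u ?y)\<^sup>2 + (dist u' ?y')\<^sup>2 \<le> (dist u ?y')\<^sup>2 + (dist u' ?y)\<^sup>2"
    using prox_objective_resolvent_le[OF \<tau> resolvent_in_Dom[OF \<tau>, of u'], of u]
      prox_objective_resolvent_le[OF \<tau> resolvent_in_Dom[OF \<tau>, of u], of u']
    by (simp add: prox_objective_def dist_commute field_simps)
  with quadrilateral_inequality[of u ?y' u' ?y]
  have "dist ?y ?y' * dist ?y ?y' \<le> dist u u' * dist ?y ?y'"
    by (simp add: power2_eq_square)
  then show ?thesis using False by simp
qed simp

text \<open>The resolvent identity: moving from \<open>u\<close> towards its resolvent point and shortening the time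
  step in proportion to the distance left does not change the resolvent point. In Euclidean space
  both sides say that \<open>(u - y)/\<tau>\<close> is a subgradient of \<open>F\<close> at \<open>y\<close>. Here, with \<open>k = \<mu>/\<tau>\<close>, a competitor
  \<open>v\<close> for the short step is made a competitor for the long one by the triangle inequality through
  \<open>w = \<gamma> k\<close>, with its square split in the proportion \<open>1 - k : k\<close> in which \<open>w\<close> divides the geodesic
  between \<open>u\<close> and \<open>y\<close>.\<close>

lemma resolvent_on_geodesic:
  assumes \<mu>: "0 < \<mu>" "\<mu> \<le> \<tau>"
    and \<gamma>: "geodesic \<gamma>" "\<gamma> 0 = resolvent F \<tau> u" "\<gamma> 1 = u"
  shows "resolvent F \<mu> (\<gamma> (\<mu> / \<tau>)) = resolvent F \<tau> u"
proof (cases "\<mu> = \<tau>")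
  case True
  then show ?thesis using \<mu> \<gamma> by simp
next
  case False
  define y w k v D where "y = resolvent F \<tau> u" and "w = \<gamma> (\<mu> / \<tau>)" and "k = \<mu> / \<tau>"
    and "v = resolvent F \<mu> w" and "D = dist u y"
  have \<tau>: "\<tau> > 0" using \<mu> by simp
  have k: "0 < k" "k < 1" "k \<in> {0..1}" using \<mu> False by (auto simp: k_def)
  have \<mu>k: "\<mu> = k * \<tau>" using \<tau> by (simp add: k_def)
  have wy: "dist w y = k * D"
    using geodesic_dist[OF \<gamma>(1) k(3), of 0] \<gamma> k by (simp add: w_def k_def[symmetric] y_def D_def dist_commute)
  have wu: "dist w u = (1 - k) * D"
    using geodesic_dist[OF \<gamma>(1) k(3), of 1] \<gamma> k
    by (simp add: w_def k_def[symmetric] y_def D_def dist_commute)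
  have vD: "v \<in> Dom F" and yD: "y \<in> Dom F"
    using resolvent_in_Dom \<mu> \<tau> by (auto simp: v_def y_def)
  have "(dist u v)\<^sup>2 \<le> ((1 - k) * D + dist w v)\<^sup>2"
    using dist_triangle[of u v w] wu by (intro power_mono) (auto simp: dist_commute)
  also have "\<dots> \<le> ((1 - k) * D)\<^sup>2 / (1 - k) + (dist w v)\<^sup>2 / k"
    using sum_power2_le_weighted[of "1 - k" "(1 - k) * D" "dist w v"] k by simp
  also have "\<dots> = (1 - k) * D\<^sup>2 + (dist w v)\<^sup>2 / k"
    using k by (simp add: power2_eq_square)
  finally have "k * (dist u v)\<^sup>2 \<le> k * ((1 - k) * D\<^sup>2 + (dist w v)\<^sup>2 / k)"
    using k by (intro mult_left_mono) auto
  then have uv: "k * (dist u v)\<^sup>2 \<le> k * D\<^sup>2 - k\<^sup>2 * D\<^sup>2 + (dist w v)\<^sup>2"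
    using k by (simp add: power2_eq_square algebra_simps)
  have "k * (prox_objective \<tau> u y + (dist y v)\<^sup>2 / 2) \<le> k * prox_objective \<tau> u v"
    using prox_objective_resolvent_le[OF \<tau> vD, of u] k by (intro mult_left_mono) (auto simp: y_def)
  then have "k * D\<^sup>2 + k * (dist y v)\<^sup>2 + 2 * (\<mu> * f y) \<le> k * (dist u v)\<^sup>2 + 2 * (\<mu> * f v)"
    by (simp add: prox_objective_def \<mu>k D_def field_simps)
  moreover have "(dist w v)\<^sup>2 + 2 * (\<mu> * f v) + (dist v y)\<^sup>2 \<le> (k * D)\<^sup>2 + 2 * (\<mu> * f y)"
    using prox_objective_resolvent_le[OF \<mu>(1) yD, of w] by (simp add: prox_objective_def v_def[symmetric] wy field_simps)
  moreover have "0 \<le> k * (dist y v)\<^sup>2" using k by simp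
  ultimately have "(dist v y)\<^sup>2 \<le> 0"
    using uv unfolding power_mult_distrib by linarith
  then show ?thesis by (simp add: v_def w_def y_def)
qed

section \<open>Convergence of the iterated resolvents\<close>

lemma resolvent_iterate_in_Dom:
  assumes "\<tau> > 0" "x \<in> Dom F"
  shows "(resolvent F \<tau> ^^ n) x \<in> Dom F"
  using assms by (cases n) (auto intro: resolvent_in_Dom)

lemma resolvent_iterate_nonexpansive:
  assumes "\<tau> > 0"
  shows "dist ((resolvent F \<tau> ^^ n) x) ((resolvent F \<tau> ^^ n) y) \<le> dist x y"
proof (induction n)
  case (Suc n)
  show ?case
    using resolvent_nonexpansive[OF assms] Suc by (auto intro: order.trans)
qed simp

lemma dist_resolvent_iterate_le:
  assumes \<tau>: "\<tau> > 0" and x: "x \<in> Dom F"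
    and L: "L \<ge> 0" "\<And>v. v \<in> Dom F \<Longrightarrow> f x - f v \<le> L * dist x v"
  shows "dist ((resolvent F \<tau> ^^ n) x) x \<le> L * (real n * \<tau>)"
proof (induction n)
  case (Suc n)
  let ?J = "resolvent F \<tau>"
  have "dist x (?J x) * dist x (?J x) \<le> \<tau> * (f x - f (?J x))"
    using resolvent_descent[OF \<tau> x] by (simp add: power2_eq_square)
  also have "\<dots> \<le> \<tau> * (L * dist x (?J x))"
    using \<tau> L resolvent_in_Dom[OF \<tau>] by (intro mult_left_mono) auto
  finally have one: "dist x (?J x) \<le> L * \<tau>"
    using L \<tau> by (cases "dist x (?J x) = 0") (auto simp: mult.commute)
  have "dist ((?J ^^ Suc n) x) x \<le> dist ((?J ^^ n) (?J x)) ((?J ^^ n) x) + dist ((?J ^^ n) x) x"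
    by (simp add: funpow_swap1 dist_triangle)
  also have "\<dots> \<le> L * \<tau> + L * (real n * \<tau>)"
    using resolvent_iterate_nonexpansive[OF \<tau>, of n "?J x" x] one Suc by (simp add: dist_commute)
  finally show ?case by (simp add: algebra_simps)
qed simp

text \<open>Induction on both numbers of steps. By the resolvent identity and nonexpansiveness, the distance
  for \<open>(m+1, n+1)\<close> is at most the convex combination, with weights \<open>1 - \<mu>/\<tau>\<close> and \<open>\<mu>/\<tau>\<close>, of those for
  \<open>(m+1, n)\<close> and \<open>(m, n)\<close>. The radicand solves the corresponding recursion exactly: it is the second
  moment of \<open>m \<tau>\<close> minus the sum of \<open>n\<close> independent steps, each equal to \<open>\<tau>\<close> with probability
  \<open>\<mu>/\<tau>\<close> and to \<open>0\<close> otherwise, with mean \<open>\<mu>\<close> and variance \<open>\<mu> (\<tau> - \<mu>)\<close>.\<close>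

lemma dist_resolvent_iterates_le:
  assumes \<mu>: "0 < \<mu>" "\<mu> \<le> \<tau>" and x: "x \<in> Dom F"
    and L: "L \<ge> 0" "\<And>v. v \<in> Dom F \<Longrightarrow> f x - f v \<le> L * dist x v"
  shows "dist ((resolvent F \<tau> ^^ m) x) ((resolvent F \<mu> ^^ n) x)
    \<le> L * sqrt ((real m * \<tau> - real n * \<mu>)\<^sup>2 + real n * \<mu> * (\<tau> - \<mu>))"
proof (induction n arbitrary: m)
  case 0
  show ?case
    using dist_resolvent_iterate_le[of \<tau> x L m] assms by simp
next
  case (Suc n)
  have \<tau>: "\<tau> > 0" using \<mu> by simp
  show ?case
  proof (cases m)
    case 0
    have "real (Suc n) * \<mu> \<le> sqrt ((0 * \<tau> - real (Suc n) * \<mu>)\<^sup>2 + real (Suc n) * \<mu> * (\<tau> - \<mu>))"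
      using \<mu> by (intro real_le_rsqrt) simp
    then have "L * (real (Suc n) * \<mu>)
        \<le> L * sqrt ((0 * \<tau> - real (Suc n) * \<mu>)\<^sup>2 + real (Suc n) * \<mu> * (\<tau> - \<mu>))"
      using L by (intro mult_left_mono) auto
    moreover have "dist ((resolvent F \<mu> ^^ Suc n) x) x \<le> L * (real (Suc n) * \<mu>)"
      by (rule dist_resolvent_iterate_le[OF \<mu>(1) x L])
    ultimately show ?thesis
      unfolding 0 by (simp only: funpow_0 dist_commute of_nat_0)
  next
    case (Suc m')
    define p q y k where "p = (resolvent F \<tau> ^^ m') x" and "q = (resolvent F \<mu> ^^ n) x"
      and "y = resolvent F \<tau> p" and "k = \<mu> / \<tau>"
    have k: "k \<in> {0..1}" "k * \<tau> = \<mu>" using \<mu> by (auto simp: k_def)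
    obtain \<gamma> where \<gamma>: "geodesic \<gamma>" "\<gamma> 0 = y" "\<gamma> 1 = p" using ex_geodesic by blast
    define A where "A = (real m * \<tau> - real n * \<mu>)\<^sup>2 + real n * \<mu> * (\<tau> - \<mu>)"
    define B where "B = (real m' * \<tau> - real n * \<mu>)\<^sup>2 + real n * \<mu> * (\<tau> - \<mu>)"
    have AB: "A \<ge> 0" "B \<ge> 0" using \<mu> by (simp_all add: A_def B_def)
    have "dist y (resolvent F \<mu> q) \<le> dist (\<gamma> k) q"
      using resolvent_nonexpansive[OF \<mu>(1), of "\<gamma> k" q] resolvent_on_geodesic[OF \<mu> \<gamma>(1)] \<gamma>
      by (simp add: y_def k_def)
    also have "\<dots> \<le> (1 - k) * dist y q + k * dist p q"
      using geodesic_dist_le[OF \<gamma>(1) k(1), of q] \<gamma> by simp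
    also have "\<dots> \<le> (1 - k) * (L * sqrt A) + k * (L * sqrt B)"
    proof -
      have "dist y q \<le> L * sqrt A" "dist p q \<le> L * sqrt B"
        using Suc.IH[of m] Suc.IH[of m'] by (simp_all add: y_def p_def q_def A_def B_def Suc)
      then show ?thesis using k by (intro add_mono mult_left_mono) auto
    qed
    also have "\<dots> = L * ((1 - k) * sqrt A + k * sqrt B)"
      by (simp add: algebra_simps)
    also have "\<dots> \<le> L * sqrt ((1 - k) * A + k * B)"
    proof (intro mult_left_mono real_le_rsqrt L)
      \<comment> \<open>Concavity of the square root, with the defect written out.\<close>
      have "0 \<le> k * (1 - k) * (sqrt A - sqrt B)\<^sup>2" using k by simp
      also have "k * (1 - k) * (sqrt A - sqrt B)\<^sup>2
          = (1 - k) * (sqrt A)\<^sup>2 + k * (sqrt B)\<^sup>2 - ((1 - k) * sqrt A + k * sqrt B)\<^sup>2"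
        by (simp only: power2_eq_square) algebra
      finally show "((1 - k) * sqrt A + k * sqrt B)\<^sup>2 \<le> (1 - k) * A + k * B"
        using AB by simp
    qed
    also have "(1 - k) * A + k * B
        = (real m * \<tau> - real (Suc n) * \<mu>)\<^sup>2 + real (Suc n) * \<mu> * (\<tau> - \<mu>)"
      unfolding A_def B_def k(2)[symmetric] Suc of_nat_Suc power2_eq_square by algebra
    finally show ?thesis by (simp add: y_def p_def q_def Suc)
  qed
qed

text \<open>The descent estimate and the linear lower bound give \<open>d\<^sup>2 \<le> \<epsilon> (1 + d / r)\<close> for the distance \<open>d\<close>
  moved. If \<open>d \<ge> e\<close>, then \<open>1 \<le> d / e\<close>, and dividing by \<open>d\<close> bounds \<open>d\<close> by a multiple of \<open>\<epsilon>\<close>.\<close>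

lemma resolvent_arbitrarily_close:
  assumes x: "x \<in> Dom F" and e: "e > 0"
  obtains \<epsilon> where "\<epsilon> > 0" "dist x (resolvent F \<epsilon> x) < e"
proof -
  obtain r where r: "r > 0" "\<And>v. v \<in> Dom F \<Longrightarrow> f x - 1 - dist x v / r \<le> f v"
    using linear_lower_bound[OF x] by blast
  define K \<epsilon> where "K = 1 / e + 1 / r" and "\<epsilon> = e / (2 * K)"
  have K: "K > 0" using e r by (simp add: K_def add_pos_pos)
  have \<epsilon>: "\<epsilon> > 0" "\<epsilon> * K < e" using e K by (auto simp: \<epsilon>_def)
  define d where "d = dist x (resolvent F \<epsilon> x)"
  have "d < e"
  proof (rule ccontr)
    assume "\<not> d < e"
    then have d: "d \<ge> e" "d > 0" using e by auto
    have "d\<^sup>2 \<le> \<epsilon> * (f x - f (resolvent F \<epsilon> x))"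
      using resolvent_descent[OF \<epsilon>(1) x] by (simp add: d_def)
    also have "\<dots> \<le> \<epsilon> * (d / e + d / r)"
    proof (intro mult_left_mono)
      have "1 \<le> d / e" using d e by simp
      then show "f x - f (resolvent F \<epsilon> x) \<le> d / e + d / r"
        using r(2)[OF resolvent_in_Dom[OF \<epsilon>(1), of x]] by (simp add: d_def)
    qed (use \<epsilon> in simp)
    also have "\<dots> = (\<epsilon> * K) * d" by (simp add: K_def algebra_simps)
    finally have "d \<le> \<epsilon> * K" using d by (simp add: power2_eq_square)
    then show False using \<epsilon> d by simp
  qed
  then show thesis using that \<epsilon> by (simp add: d_def)
qed

text \<open>The estimate for the iterates needs a starting point with a Lipschitz bound below. A resolvent
  point \<open>z = J\<^sub>\<epsilon> x\<close> has one and can be taken arbitrarily close to \<open>x\<close>; by nonexpansiveness, replacing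
  \<open>x\<close> by \<open>z\<close> moves all iterates by at most \<open>d(x,z)\<close>.\<close>

lemma gradient_flow_LIMSEQ:
  assumes x: "x \<in> Dom F" and t: "t > 0"
  shows "(\<lambda>m. (resolvent F (t / real m) ^^ m) x) \<longlonglongrightarrow> gradient_flow F x t"
proof -
  let ?S = "\<lambda>z m. (resolvent F (t / real m) ^^ m) z"
  have close: "dist (?S x m) (?S x n) \<le> 2 * dist x z + L * (t / sqrt (real m))"
    if mn: "0 < m" "m \<le> n" and \<epsilon>: "\<epsilon> > 0" and z: "z = resolvent F \<epsilon> x" and L: "L = dist x z / \<epsilon>"
    for m n \<epsilon> z L
  proof -
    have zD: "z \<in> Dom F" using resolvent_in_Dom \<epsilon> z by simp
    have L0: "L \<ge> 0" using \<epsilon> L by simp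
    have le: "t / real n \<le> t / real m" using mn t by (intro divide_left_mono) auto
    have "dist (?S z m) (?S z n) \<le> L * sqrt ((real m * (t / real m) - real n * (t / real n))\<^sup>2
        + real n * (t / real n) * (t / real m - t / real n))"
      using resolvent_descent_rate[OF \<epsilon>] L z mn t
      by (intro dist_resolvent_iterates_le zD L0 le) auto
    also have "\<dots> = L * sqrt (t * (t / real m - t / real n))"
      using mn by simp
    also have "\<dots> \<le> L * sqrt (t\<^sup>2 / real m)"
      using mn t L0 by (intro mult_left_mono) (auto simp: power2_eq_square algebra_simps)
    also have "\<dots> = L * (t / sqrt (real m))"
      using t by (simp add: real_sqrt_divide)
    finally have "dist (?S z m) (?S z n) \<le> L * (t / sqrt (real m))" .
    moreover have "dist (?S x m) (?S z m) \<le> dist x z" "dist (?S x n) (?S z n) \<le> dist x z"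
      using mn t by (auto intro!: resolvent_iterate_nonexpansive)
    moreover have "dist (?S x m) (?S x n)
        \<le> dist (?S x m) (?S z m) + dist (?S z m) (?S z n) + dist (?S x n) (?S z n)"
      by (metis add_right_mono dist_commute dist_triangle dist_triangle_le)
    ultimately show ?thesis by linarith
  qed
  have "Cauchy (?S x)"
  proof (rule metric_CauchyI)
    fix e :: real assume e: "e > 0"
    obtain \<epsilon> where \<epsilon>: "\<epsilon> > 0" "dist x (resolvent F \<epsilon> x) < e / 4"
      using resolvent_arbitrarily_close[OF x, of "e / 4"] e by auto
    define z L where "z = resolvent F \<epsilon> x" and "L = dist x z / \<epsilon>"
    have "(\<lambda>m. L * (t * inverse (sqrt (real m)))) \<longlonglongrightarrow> L * (t * 0)"
      by (intro tendsto_intros tendsto_inverse_0_at_top filterlim_compose[OF sqrt_at_top]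
          filterlim_real_sequentially)
    then have "eventually (\<lambda>m. L * (t * inverse (sqrt (real m))) < e / 2) sequentially"
      by (rule order_tendstoD) (use e in simp)
    then obtain N where N: "\<forall>m\<ge>N. L * (t * inverse (sqrt (real m))) < e / 2"
      unfolding eventually_sequentially by blast
    have half: "dist (?S x m) (?S x n) < e" if mn: "Suc N \<le> m" "m \<le> n" for m n
    proof -
      have "L * (t / sqrt (real m)) < e / 2"
        using N mn(1) unfolding divide_inverse by simp
      moreover have "dist (?S x m) (?S x n) \<le> 2 * dist x z + L * (t / sqrt (real m))"
        using mn by (intro close[OF _ _ \<epsilon>(1) z_def L_def]) auto
      ultimately show ?thesis
        using \<epsilon>(2) unfolding z_def[symmetric] by linarith
    qed
    show "\<exists>M. \<forall>m\<ge>M. \<forall>n\<ge>M. dist (?S x m) (?S x n) < e"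
    proof (intro exI[of _ "Suc N"] allI impI)
      fix m n assume "Suc N \<le> m" "Suc N \<le> n"
      then show "dist (?S x m) (?S x n) < e"
        using half[of m n] half[of n m] dist_commute[of "?S x m"] by (metis nat_le_linear)
    qed
  qed
  then show ?thesis
    unfolding gradient_flow_def
    using Cauchy_convergent convergent_LIMSEQ_iff by blast
qed

section \<open>Decrease of the function along its gradient flow\<close>

text \<open>A step of length \<open>d\<close> lowers \<open>F\<close> by at least \<open>d\<^sup>2/\<tau>\<close>; using \<open>d/\<tau> \<ge> s\<close> once or twice gives the two
  bounds for a single step.\<close>

lemma resolvent_iterate_decrease:
  assumes \<tau>: "\<tau> > 0" and x: "x \<in> Dom F"
    and s: "s \<ge> 0" "\<And>u. s * \<tau> \<le> dist u (resolvent F \<tau> u)"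
  shows "s * dist x ((resolvent F \<tau> ^^ n) x) \<le> f x - f ((resolvent F \<tau> ^^ n) x)
    \<and> s\<^sup>2 * (real n * \<tau>) \<le> f x - f ((resolvent F \<tau> ^^ n) x)"
proof (induction n)
  case (Suc n)
  define u y d where "u = (resolvent F \<tau> ^^ n) x" and "y = resolvent F \<tau> u" and "d = dist u y"
  have d: "d * d \<le> \<tau> * (f u - f y)"
    using resolvent_descent[OF \<tau> resolvent_iterate_in_Dom[OF \<tau> x, of n]]
    by (simp add: u_def y_def d_def power2_eq_square)
  have sd: "s * \<tau> \<le> d" using s by (simp add: d_def y_def)
  have "s * \<tau> * d \<le> d * d" using sd by (intro mult_right_mono) (auto simp: d_def)
  then have "\<tau> * (s * d) \<le> \<tau> * (f u - f y)" using d by (simp add: algebra_simps)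
  then have 1: "s * d \<le> f u - f y" using \<tau> by simp
  have 2: "s * (s * \<tau>) \<le> s * d" using sd s by (intro mult_left_mono) auto
  have "s * dist x y \<le> s * (dist x u + d)"
    using s by (intro mult_left_mono) (auto simp: d_def dist_triangle)
  with 1 2 Suc show ?case
    by (simp add: u_def[symmetric] y_def[symmetric] power2_eq_square algebra_simps)
qed simp

text \<open>The hypothesis on \<open>s\<close> is the form in which a lower bound \<open>s\<close> for all slopes enters.\<close>

lemma gradient_flow_decrease:
  assumes x: "x \<in> Dom F" and t: "t > 0"
    and s: "s \<ge> 0" "\<And>u \<tau>. \<tau> > 0 \<Longrightarrow> s * \<tau> \<le> dist u (resolvent F \<tau> u)"
  shows "gradient_flow F x t \<in> Dom F"
    and "s * dist x (gradient_flow F x t) \<le> f x - f (gradient_flow F x t)"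
    and "s\<^sup>2 * t \<le> f x - f (gradient_flow F x t)"
proof -
  define c y where "c = gradient_flow F x t" and "y = (\<lambda>m. (resolvent F (t / real m) ^^ m) x)"
  have lim: "y \<longlonglongrightarrow> c" unfolding c_def y_def by (rule gradient_flow_LIMSEQ[OF x t])
  have yD: "y m \<in> Dom F" if "m > 0" for m
    unfolding y_def using t x that by (intro resolvent_iterate_in_Dom) auto
  have dec: "s * dist x (y m) \<le> f x - f (y m)" "s\<^sup>2 * t \<le> f x - f (y m)" if "m > 0" for m
  proof -
    have \<tau>: "t / real m > 0" using t that by simp
    show "s * dist x (y m) \<le> f x - f (y m)" "s\<^sup>2 * t \<le> f x - f (y m)"
      using resolvent_iterate_decrease[OF \<tau> x s(1) s(2)[OF \<tau>], of m] that by (auto simp: y_def)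
  qed
  have "F c \<le> ereal (f x - s\<^sup>2 * t)"
  proof (rule lower_semicontinuous_limit_le[OF lsc lim])
    show "eventually (\<lambda>m. F (y m) \<le> ereal (f x - s\<^sup>2 * t)) sequentially"
      using eventually_gt_at_top[of "0::nat"]
    proof (rule eventually_mono)
      fix m :: nat assume "0 < m"
      then show "F (y m) \<le> ereal (f x - s\<^sup>2 * t)"
        using dec(2)[of m] yD[of m] by (simp add: f_le_iff)
    qed
  qed
  moreover from this show cD: "gradient_flow F x t \<in> Dom F"
    unfolding c_def by (rule in_Dom_if_le)
  ultimately show "s\<^sup>2 * t \<le> f x - f (gradient_flow F x t)"
    by (simp add: f_le_iff c_def)
  have "f c \<le> f x - s * dist x c + e" if e: "e > 0" for e
  proof -
    have "(\<lambda>m. f x - s * dist x (y m)) \<longlonglongrightarrow> f x - s * dist x c"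
      by (intro tendsto_intros lim)
    then have ev: "eventually (\<lambda>m. f x - s * dist x (y m) < f x - s * dist x c + e) sequentially"
      by (rule order_tendstoD) (use e in simp)
    have "F c \<le> ereal (f x - s * dist x c + e)"
    proof (rule lower_semicontinuous_limit_le[OF lsc lim, OF eventually_mono[OF eventually_conj[OF ev]]])
      show "eventually (\<lambda>m. m > (0::nat)) sequentially" by (rule eventually_gt_at_top)
      fix m :: nat assume "f x - s * dist x (y m) < f x - s * dist x c + e \<and> m > 0"
      then show "F (y m) \<le> ereal (f x - s * dist x c + e)"
        using dec(1)[of m] yD[of m] by (simp add: f_le_iff)
    qed
    then show ?thesis using cD by (simp add: f_le_iff c_def)
  qed
  then have "f c \<le> f x - s * dist x c" by (rule field_le_epsilon)
  then show "s * dist x (gradient_flow F x t) \<le> f x - f (gradient_flow F x t)"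
    by (simp add: c_def)
qed

section \<open>Slopes\<close>

lemma slope_quotient_eq:
  assumes "y \<in> Dom F" "z \<in> Dom F" "z \<noteq> y"
  shows "max (F y - F z) 0 / ereal (dist y z) = ereal (max (f y - f z) 0 / dist y z)"
  using assms by (cases "f z \<le> f y") (auto simp: F_eq max_def)

lemma slope_resolvent_le:
  assumes \<tau>: "\<tau> > 0"
  shows "slope F (resolvent F \<tau> u) \<le> ereal (dist u (resolvent F \<tau> u) / \<tau>)"
proof -
  let ?y = "resolvent F \<tau> u"
  let ?K = "dist u ?y / \<tau>"
  have K: "?K \<ge> 0" using \<tau> by simp
  have yD: "?y \<in> Dom F" by (rule resolvent_in_Dom[OF \<tau>])
  have "max (F ?y - F z) 0 / ereal (dist ?y z) \<le> ereal ?K" if "z \<noteq> ?y" for z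
  proof (cases "z \<in> Dom F")
    case True
    have "max (f ?y - f z) 0 \<le> ?K * dist ?y z"
      using resolvent_descent_rate[OF \<tau> True, of u] mult_nonneg_nonneg[OF K zero_le_dist, of ?y z]
      by (rule max.boundedI)
    then have "max (f ?y - f z) 0 / dist ?y z \<le> ?K"
      using that by (simp add: divide_le_eq)
    then show ?thesis
      by (simp add: slope_quotient_eq[OF yD True that])
  next
    case False
    then show ?thesis
      using yD K that by (simp add: F_eq F_eq_PInfty)
  qed
  then have "Limsup (at ?y) (\<lambda>z. max (F ?y - F z) 0 / ereal (dist ?y z)) \<le> ereal ?K"
    by (intro Limsup_bounded) (auto simp: eventually_at_filter)
  then show ?thesis
    unfolding slope_def using yD K by simp
qed

text \<open>Convexity makes the difference quotients of \<open>F\<close> at \<open>y\<close> grow as one approaches \<open>y\<close> along the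
  geodesic from \<open>z\<close>. A quotient larger than \<open>L\<close> at \<open>z\<close> would thus persist up to \<open>y\<close> and exceed the
  slope.\<close>

lemma le_slope_mult_dist:
  assumes y: "y \<in> Dom F" and z: "z \<in> Dom F" and L: "slope F y \<le> ereal L"
  shows "f y - f z \<le> L * dist y z"
proof (rule ccontr)
  assume less: "\<not> ?thesis"
  define d K where "d = dist y z" and "K = (f y - f z) / d"
  have "y \<noteq> z" using less by auto
  then have d: "d > 0" by (simp add: d_def)
  have K: "L < K" using less d by (simp add: K_def d_def field_simps)
  let ?q = "\<lambda>z. max (F y - F z) 0 / ereal (dist y z)"
  have "Limsup (at y) ?q < ereal K"
    using L K y by (simp add: slope_def) (meson less_ereal.simps(1) order.strict_trans1)
  then have ev: "eventually (\<lambda>z. ?q z < ereal K) (at y)"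
    by (rule Limsup_lessD)
  obtain \<gamma> where \<gamma>: "geodesic \<gamma>" "\<gamma> 0 = y" "\<gamma> 1 = z" using ex_geodesic by blast
  from ev obtain e where e: "e > 0" "\<And>z. z \<noteq> y \<Longrightarrow> dist z y < e \<Longrightarrow> ?q z < ereal K"
    by (auto simp: eventually_at)
  define t where "t = min 1 (e / (2 * d))"
  have t: "t \<in> {0..1}" "t > 0" "t * d < e"
    using e d by (auto simp: t_def min_mult_distrib_right)
  have dt: "dist y (\<gamma> t) = t * d"
    using geodesic_dist[OF \<gamma>(1) _ t(1), of 0] \<gamma> t by (simp add: d_def)
  then have \<gamma>y: "\<gamma> t \<noteq> y" using t d by auto
  have lt: "?q (\<gamma> t) < ereal K"
    using dt d t by (intro e) (auto simp: dist_commute)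
  have \<gamma>D: "\<gamma> t \<in> Dom F" using geodesic_in_Dom[OF \<gamma>(1)] \<gamma> y z t by simp
  have "f (\<gamma> t) \<le> (1 - t) * f y + t * f z"
    using f_geodesic_le[OF \<gamma>(1), of t] \<gamma> y z t by simp
  then have "t * (f y - f z) \<le> f y - f (\<gamma> t)" by (simp add: algebra_simps)
  then have "K * (t * d) \<le> f y - f (\<gamma> t)" using d by (simp add: K_def mult.commute)
  then have "K \<le> (f y - f (\<gamma> t)) / (t * d)" using t d by (simp add: pos_le_divide_eq)
  also have "\<dots> \<le> max (f y - f (\<gamma> t)) 0 / (t * d)" using t d by (intro divide_right_mono) auto
  finally have "ereal K \<le> ?q (\<gamma> t)"
    unfolding slope_quotient_eq[OF y \<gamma>D \<gamma>y] unfolding dt by simp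
  with lt show False by simp
qed

end

text \<open>Since \<open>0 * \<infinity> = 0\<close>, the function \<open>F\<close> drops out even outside its domain.\<close>

lemma resolvent_0: "resolvent F 0 u = u"
proof -
  have "(\<lambda>v. ereal (1 / 2 * (dist u v)\<^sup>2) + ereal 0 * F v) = (\<lambda>v. ereal ((dist u v)\<^sup>2 / 2))"
    by (simp add: zero_ereal_def[symmetric])
  then show ?thesis
    unfolding resolvent_def arg_min_def
    by (intro some_equality) (auto simp: is_arg_min_linorder dest: spec[of _ u])
qed

lemma gradient_flow_0: "gradient_flow F x 0 = x"
proof -
  have "(resolvent F 0 ^^ m) x = x" for m
    by (induction m) (simp_all add: resolvent_0)
  then show ?thesis by (simp add: gradient_flow_def)
qed

section \<open>Weak limits\<close>

definition geodesically_convex_set :: "'a::metric_space set \<Rightarrow> bool" where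
  "geodesically_convex_set S \<longleftrightarrow>
     (\<forall>\<gamma>. geodesic \<gamma> \<longrightarrow> \<gamma> 0 \<in> S \<longrightarrow> \<gamma> 1 \<in> S \<longrightarrow> (\<forall>t\<in>{0..1}. \<gamma> t \<in> S))"

lemma geodesically_convex_setD:
  assumes "geodesically_convex_set S" "geodesic \<gamma>" "\<gamma> 0 \<in> S" "\<gamma> 1 \<in> S" "t \<in> {0..1}"
  shows "\<gamma> t \<in> S"
  using assms unfolding geodesically_convex_set_def by blast

text \<open>The resolvent of this function is the metric projection to \<open>S\<close>.\<close>

lemma convex_lsc_function_indicator:
  fixes S :: "'a::hadamard_space set"
  assumes "closed S" "S \<noteq> {}" "geodesically_convex_set S"
  shows "convex_lsc_function (\<lambda>x. if x \<in> S then 0 else \<infinity>)"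
proof
  let ?I = "\<lambda>x. if x \<in> S then 0 else (\<infinity>::ereal)"
  show "?I x \<noteq> -\<infinity>" for x by simp
  show "geodesically_convex ?I"
    unfolding geodesically_convex_def
  proof (intro allI impI ballI)
    fix \<gamma> :: "real \<Rightarrow> 'a" and t :: real assume \<gamma>: "geodesic \<gamma>" "t \<in> {0..1}"
    have both: "\<gamma> t \<in> S" if "\<gamma> 0 \<in> S" "\<gamma> 1 \<in> S"
      using assms(3) \<gamma> that unfolding geodesically_convex_set_def by blast
    consider "\<gamma> 0 \<in> S" "\<gamma> 1 \<in> S" | "t = 0" | "t = 1" | "0 < t" "t < 1" "\<gamma> 0 \<notin> S \<or> \<gamma> 1 \<notin> S"
      using \<gamma> by fastforce
    then show "?I (\<gamma> t) \<le> ereal (1 - t) * ?I (\<gamma> 0) + ereal t * ?I (\<gamma> 1)"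
      using both by cases auto
  qed
  show "lower_semicontinuous ?I"
    unfolding lower_semicontinuous_def
  proof
    fix x
    show "?I x \<le> Liminf (at x) ?I"
    proof (cases "x \<in> S")
      case True
      then show ?thesis by (intro Liminf_bounded) auto
    next
      case False
      then have "eventually (\<lambda>y. y \<in> - S) (at x)"
        using assms(1) by (intro eventually_at_in_open') auto
      then show ?thesis
        using False by (intro Liminf_bounded) (auto elim: eventually_mono)
    qed
  qed
  show "Dom ?I \<noteq> {}"
    using assms(2) by (auto simp: Dom_def zero_ereal_def)
qed

text \<open>The projection \<open>p\<close> of the weak limit \<open>l\<close> to \<open>S\<close> is at least as close to every point of \<open>S\<close> as
  \<open>l\<close>, hence also minimizes the asymptotic distance to the sequence. Uniqueness of the minimizer gives
  \<open>p = l\<close>.\<close>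

lemma weak_limit_in_closed_convex:
  fixes S :: "'a::hadamard_space set"
  assumes "closed S" "geodesically_convex_set S"
    and X: "weakly_converges X l" "eventually (\<lambda>n. X n \<in> S) sequentially"
  shows "l \<in> S"
proof -
  have "S \<noteq> {}" using X(2) by (auto simp: eventually_sequentially)
  interpret I: convex_lsc_function "\<lambda>x. if x \<in> S then 0 else (\<infinity>::ereal)"
    by (rule convex_lsc_function_indicator[OF assms(1) \<open>S \<noteq> {}\<close> assms(2)])
  let ?I = "\<lambda>x. if x \<in> S then 0 else (\<infinity>::ereal)"
  define p where "p = resolvent ?I 1 l"
  have D: "v \<in> Dom ?I \<longleftrightarrow> v \<in> S" for v by (auto simp: Dom_def zero_ereal_def)
  have pS: "p \<in> S" using I.resolvent_in_Dom[of 1 l] by (simp add: p_def D)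
  have le: "dist p v \<le> dist l v" if "v \<in> S" for v
  proof (rule power2_le_imp_le)
    have "(dist l p)\<^sup>2 + (dist p v)\<^sup>2 \<le> (dist l v)\<^sup>2"
      using I.prox_objective_resolvent_le[of 1 v l] that pS
      by (simp add: D p_def[symmetric] I.prox_objective_def I.f_def)
    then show "(dist p v)\<^sup>2 \<le> (dist l v)\<^sup>2"
      using zero_le_power2[of "dist l p"] by linarith
  qed simp
  let ?r = "\<lambda>z. limsup (\<lambda>k. ereal (dist z (X k)))"
  have "?r p \<le> ?r l"
    by (rule Limsup_mono) (use X(2) in \<open>auto elim!: eventually_mono intro: le\<close>)
  moreover have "\<forall>y. is_arg_min (\<lambda>z. limsup (\<lambda>k. ereal (dist z (X (id k))))) (\<lambda>_. True) y \<longleftrightarrow> y = l"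
    using X(1) strict_mono_id unfolding weakly_converges_def by blast
  then have arg: "is_arg_min ?r (\<lambda>_. True) y \<longleftrightarrow> y = l" for y
    unfolding id_def by (rule spec)
  then have "is_arg_min ?r (\<lambda>_. True) l" by simp
  ultimately have "is_arg_min ?r (\<lambda>_. True) p"
    unfolding is_arg_min_linorder by (meson order.trans)
  then show ?thesis using arg pS by simp
qed

lemma (in convex_lsc_function) sublevel_convex:
  "geodesically_convex_set {x. F x \<le> ereal b}"
  unfolding geodesically_convex_set_def
proof (intro allI impI ballI)
  fix \<gamma> :: "real \<Rightarrow> 'a" and t :: real
  assume \<gamma>: "geodesic \<gamma>" "\<gamma> 0 \<in> {x. F x \<le> ereal b}" "\<gamma> 1 \<in> {x. F x \<le> ereal b}" "t \<in> {0..1}"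
  have D: "\<gamma> 0 \<in> Dom F" "\<gamma> 1 \<in> Dom F" using \<gamma> in_Dom_if_le by auto
  have le: "f (\<gamma> 0) \<le> b" "f (\<gamma> 1) \<le> b" using D \<gamma> by (auto simp: f_le_iff)
  have "f (\<gamma> t) \<le> (1 - t) * f (\<gamma> 0) + t * f (\<gamma> 1)"
    by (rule f_geodesic_le[OF \<gamma>(1) D \<gamma>(4)])
  also have "\<dots> \<le> b"
    using \<gamma>(4) by (intro convex_bound_le le) auto
  finally show "\<gamma> t \<in> {x. F x \<le> ereal b}"
    using geodesic_in_Dom[OF \<gamma>(1) D \<gamma>(4)] by (simp add: f_le_iff)
qed

lemma (in convex_lsc_function) weak_limit_le:
  assumes "weakly_converges X l" "eventually (\<lambda>n. F (X n) \<le> ereal b) sequentially"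
  shows "F l \<le> ereal b"
  using weak_limit_in_closed_convex[OF closed_sublevel_of_lower_semicontinuous[OF lsc]
      sublevel_convex assms(1)] assms(2) by simp

section \<open>Growth along rays\<close>

lemma slope_nonneg: "0 \<le> slope F x"
  by (simp add: slope_def)

context convex_lsc_function
begin

text \<open>By convexity the difference quotient of \<open>F\<close> from \<open>l 0\<close> is monotone in time, so it converges to
  its supremum, and it differs from \<open>F (l t) / t\<close> by \<open>F (l 0) / t\<close>.\<close>

lemma radial_LIMSEQ:
  assumes l: "\<And>s t. s \<ge> 0 \<Longrightarrow> t \<ge> 0 \<Longrightarrow> dist (l s) (l t) = c * \<bar>s - t\<bar>" and D: "l 0 \<in> Dom F"
  shows "((\<lambda>t. F (l t) / ereal t) \<longlongrightarrow> radial F l) at_top"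
proof -
  define h where "h t = (if l t \<in> Dom F then ereal ((f (l t) - f (l 0)) / t) else \<infinity>)" for t
  have mono: "h s \<le> h t" if st: "0 < s" "s \<le> t" for s t
  proof (cases "l t \<in> Dom F")
    case True
    have t: "t > 0" using st by simp
    have \<gamma>: "geodesic (\<lambda>u. l (u * t))"
      unfolding geodesic_def using t
      by (simp add: l abs_mult left_diff_distrib[symmetric])
    have u: "s / t \<in> {0..1}" using st by simp
    have "l s \<in> Dom F"
      using geodesic_in_Dom[OF \<gamma> _ _ u] True D t by simp
    moreover have "f (l s) \<le> (1 - s / t) * f (l 0) + s / t * f (l t)"
      using f_geodesic_le[OF \<gamma> _ _ u] True D t by simp
    then have "(f (l s) - f (l 0)) / s \<le> (f (l t) - f (l 0)) / t"
      using st t by (simp add: field_simps)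
    ultimately show ?thesis using True by (simp add: h_def)
  qed (simp add: h_def)
  define S where "S = (SUP t\<in>{0<..}. h t)"
  have "(h \<longlongrightarrow> S) at_top"
  proof (rule order_tendstoI)
    fix a assume "a < S"
    then obtain s where s: "s > 0" "a < h s" by (auto simp: S_def less_SUP_iff)
    show "eventually (\<lambda>t. a < h t) at_top"
      using eventually_ge_at_top[of s] by (rule eventually_mono) (use s mono in \<open>auto intro: less_le_trans\<close>)
  next
    fix a assume a: "S < a"
    show "eventually (\<lambda>t. h t < a) at_top"
      using eventually_gt_at_top[of 0]
    proof (rule eventually_mono)
      fix t :: real assume "t > 0"
      then have "h t \<le> S" unfolding S_def by (intro SUP_upper) auto
      then show "h t < a" using a by simp
    qed
  qed
  moreover have "((\<lambda>t. ereal (f (l 0) / t)) \<longlongrightarrow> ereal 0) at_top"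
    by (intro tendsto_intros tendsto_divide_0[OF tendsto_const] filterlim_at_top_imp_at_infinity filterlim_ident)
  ultimately have "((\<lambda>t. h t + ereal (f (l 0) / t)) \<longlongrightarrow> S + ereal 0) at_top"
    by (intro tendsto_add_ereal_general1) auto
  moreover have "eventually (\<lambda>t. h t + ereal (f (l 0) / t) = F (l t) / ereal t) at_top"
    using eventually_gt_at_top[of 0]
    by (rule eventually_mono) (auto simp: h_def F_eq F_eq_PInfty diff_divide_distrib)
  ultimately have lim: "((\<lambda>t. F (l t) / ereal t) \<longlongrightarrow> S) at_top"
    by (simp add: tendsto_cong zero_ereal_def[symmetric])
  then have "radial F l = S"
    unfolding radial_def by (intro tendsto_Lim) auto
  with lim show ?thesis by simp
qed

text \<open>The global form \<open>F x - F (l t) \<le> L d(x, l t)\<close> of the slope bound, divided by \<open>t\<close>: the distance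
  grows like \<open>c t\<close>, whatever the base point \<open>x\<close>.\<close>

lemma minus_radial_le_slope:
  assumes l: "\<And>s t. s \<ge> 0 \<Longrightarrow> t \<ge> 0 \<Longrightarrow> dist (l s) (l t) = c * \<bar>s - t\<bar>" and c: "c > 0"
    and D: "l 0 \<in> Dom F"
  shows "- radial F l / ereal c \<le> slope F x"
proof (cases "slope F x")
  case (real L)
  have L0: "L \<ge> 0"
    using slope_nonneg[of F x] real by simp
  have xD: "x \<in> Dom F"
    using real by (rule contrapos_pp) (simp add: slope_def)
  have "((\<lambda>t. (f x - L * dist x (l 0)) / t - L * c) \<longlongrightarrow> 0 - L * c) at_top"
    by (intro tendsto_intros tendsto_divide_0[OF tendsto_const] filterlim_at_top_imp_at_infinity filterlim_ident)
  then have lim: "((\<lambda>t. ereal ((f x - L * dist x (l 0)) / t - L * c)) \<longlongrightarrow> ereal (- (L * c))) at_top"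
    by simp
  have "ereal (- (L * c)) \<le> radial F l"
  proof (rule tendsto_le[OF _ radial_LIMSEQ[OF l D] lim])
    show "eventually (\<lambda>t. ereal ((f x - L * dist x (l 0)) / t - L * c) \<le> F (l t) / ereal t) at_top"
      using eventually_gt_at_top[of 0]
    proof (rule eventually_mono)
      fix t :: real assume t: "t > 0"
      show "ereal ((f x - L * dist x (l 0)) / t - L * c) \<le> F (l t) / ereal t"
      proof (cases "l t \<in> Dom F")
        case True
        have "f x - f (l t) \<le> L * dist x (l t)"
          using le_slope_mult_dist[OF xD True, of L] real by simp
        also have "\<dots> \<le> L * (dist x (l 0) + c * t)"
          using L0 dist_triangle[of x "l t" "l 0"] l[of 0 t] t by (intro mult_left_mono) auto
        finally have "(f x - L * dist x (l 0)) - L * c * t \<le> f (l t)"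
          by (simp add: algebra_simps)
        then have "((f x - L * dist x (l 0)) - L * c * t) / t \<le> f (l t) / t"
          using t by (intro divide_right_mono) auto
        then show ?thesis
          using t True by (simp add: F_eq diff_divide_distrib)
      next
        case False
        then show ?thesis using t by (simp add: F_eq_PInfty)
      qed
    qed
  qed simp
  then show ?thesis
    using c real by (cases "radial F l") (auto simp: field_simps)
next
  case MInf
  then show ?thesis using slope_nonneg[of F x] by simp
qed simp

end

section \<open>Limits of long geodesics\<close>

text \<open>The point at time \<open>t\<close> of the unit speed geodesic underlying \<open>g k\<close> has parameter \<open>t / d(x\<^sub>0, g k 1)\<close>;
  the minimum with \<open>1\<close> keeps the geodesic at its end once \<open>t\<close> exceeds its length, which for a given
  \<open>t\<close> happens for finitely many \<open>k\<close> only. A diagonal subsequence converges at all integer times,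
  and compatibility of \<open>\<sigma>\<close> with geodesics extends this to all times and shows that the limit is a
  geodesic on each interval from \<open>0\<close> to an integer. Its speed is at most \<open>1\<close>, as distances are
  semicontinuous for \<open>\<sigma>\<close>.\<close>

lemma limit_ray:
  fixes \<sigma> :: "'a::hadamard_space topology" and g :: "nat \<Rightarrow> real \<Rightarrow> 'a"
  assumes \<sigma>: "compatible_topology \<sigma>"
    and g: "\<And>k. geodesic (g k)" "\<And>k. g k 0 = x\<^sub>0"
    and far: "filterlim (\<lambda>k. dist x\<^sub>0 (g k 1)) at_top sequentially"
    and compact: "\<forall>X. bounded (range X) \<and> range X \<subseteq> A \<longrightarrow>
      (\<exists>l r. strict_mono (r :: nat \<Rightarrow> nat) \<and> limitin \<sigma> (X \<circ> r) l sequentially)"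
    and A: "\<And>k. g k ` {0..1} \<subseteq> A"
  shows "\<exists>r l c. strict_mono (r :: nat \<Rightarrow> nat) \<and> 0 \<le> c \<and> c \<le> 1 \<and> l \<in> rays x\<^sub>0 \<and>
    (\<forall>s\<ge>0. \<forall>t\<ge>0. dist (l s) (l t) = c * \<bar>s - t\<bar>) \<and>
    (\<forall>t\<ge>0. weakly_converges (\<lambda>j. g (r j) (min 1 (t / dist x\<^sub>0 (g (r j) 1)))) (l t))"
proof -
  define D where "D k = dist x\<^sub>0 (g k 1)" for k
  define p where "p k t = g k (min 1 (t / D k))" for k t
  have top: "topspace \<sigma> = UNIV" and haus: "Hausdorff_space \<sigma>"
    using \<sigma> by (auto simp: compatible_topology_def)
  have weak: "weakly_converges X y" if "bounded (range X)" "limitin \<sigma> X y sequentially" for X y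
    using \<sigma> that unfolding compatible_topology_def by blast
  have lsc: "ereal (dist y z) \<le> liminf (\<lambda>j. ereal (dist (X j) (Y j)))"
    if "bounded (range X)" "bounded (range Y)" "limitin \<sigma> X y sequentially" "limitin \<sigma> Y z sequentially"
    for X Y y z
    using \<sigma> that unfolding compatible_topology_def by blast
  have geod: "limitin \<sigma> (\<lambda>j. \<gamma> j t) (\<delta> t) sequentially"
    if "\<And>j. geodesic (\<gamma> j)" "geodesic \<delta>" "limitin \<sigma> (\<lambda>j. \<gamma> j 0) (\<delta> 0) sequentially"
      "limitin \<sigma> (\<lambda>j. \<gamma> j 1) (\<delta> 1) sequentially" "t \<in> {0..1}" for \<gamma> \<delta> t
    using \<sigma> that unfolding compatible_topology_def by blast
  have unique: "y = z" if "limitin \<sigma> X y sequentially" "limitin \<sigma> X z sequentially"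
    for X :: "nat \<Rightarrow> 'a" and y z
    using limitin_Hausdorff_unique[OF that _ haus] by simp
  have unit: "min 1 (t / D k) \<in> {0..1}" if "t \<ge> 0" for t k
    using that by (simp add: D_def)
  have p_dist: "dist x\<^sub>0 (p k t) \<le> t" if "t \<ge> 0" for k t
  proof -
    have "dist x\<^sub>0 (p k t) = min 1 (t / D k) * D k"
      using geodesic_dist[OF g(1) _ unit[OF that], of 0] unit[OF that, of k] by (simp add: p_def g D_def)
    also have "\<dots> \<le> t"
    proof (cases "D k = 0")
      case False
      then have "min 1 (t / D k) * D k \<le> t / D k * D k"
        by (intro mult_right_mono) (auto simp: D_def)
      then show ?thesis using False by simp
    qed (use that in simp)
    finally show ?thesis .
  qed
  have p_bounded: "bounded (range (\<lambda>j. p (s j) t))" if "t \<ge> 0" for s :: "nat \<Rightarrow> nat" and t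
    by (rule bounded_subset[OF bounded_cball[of x\<^sub>0 t]]) (use p_dist[OF that] in auto)
  have pA: "p k t \<in> A" if "t \<ge> 0" for k t
    unfolding p_def using A unit[OF that] by blast
  interpret S: subseqs "\<lambda>n s. \<exists>y. limitin \<sigma> (\<lambda>j. p (s j) (real n)) y sequentially"
  proof
    fix n :: nat and s :: "nat \<Rightarrow> nat" assume "strict_mono s"
    show "\<exists>r'. strict_mono r' \<and> (\<exists>y. limitin \<sigma> (\<lambda>j. p ((s \<circ> r') j) (real n)) y sequentially)"
      using compact[rule_format, of "\<lambda>j. p (s j) (real n)"] p_bounded[of "real n" s] pA[of "real n"]
      by (auto simp: o_def image_subset_iff)
  qed
  define r where "r = S.diagseq"
  have r: "strict_mono r" unfolding r_def by (rule S.subseq_diagseq)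
  have "\<exists>y. limitin \<sigma> (\<lambda>j. p (r j) (real n)) y sequentially" for n
  proof -
    have "\<exists>y. limitin \<sigma> (\<lambda>j. p ((r \<circ> (+) (Suc n)) j) (real n)) y sequentially"
      unfolding r_def
    proof (rule S.diagseq_holds)
      fix q s :: "nat \<Rightarrow> nat" and m
      assume q: "strict_mono q" and "\<exists>y. limitin \<sigma> (\<lambda>j. p (s j) (real m)) y sequentially"
      then obtain y where "limitin \<sigma> (\<lambda>j. p (s j) (real m)) y sequentially" by blast
      from limitin_subsequence[OF q this]
      show "\<exists>y. limitin \<sigma> (\<lambda>j. p ((s \<circ> q) j) (real m)) y sequentially"
        by (auto simp: o_def)
    qed
    then obtain y where "limitin \<sigma> (\<lambda>j. p (r (j + Suc n)) (real n)) y sequentially"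
      by (auto simp: add.commute)
    from limitin_sequentially_offset_rev[OF this] show ?thesis by blast
  qed
  then obtain L where L: "\<And>n. limitin \<sigma> (\<lambda>j. p (r j) (real n)) (L n) sequentially" by metis
  have far_r: "eventually (\<lambda>j. a \<le> D (r j)) sequentially" for a
    using filterlim_compose[OF far filterlim_subseq[OF r]]
    by (simp add: filterlim_at_top D_def)
  have start: "limitin \<sigma> (\<lambda>j. x\<^sub>0) x\<^sub>0 sequentially"
    by (simp add: top)
  have segment: "\<exists>\<delta>. geodesic \<delta> \<and> (\<forall>t\<in>{0..real n}.
      limitin \<sigma> (\<lambda>j. p (r j) t) (\<delta> (t / real n)) sequentially)" if n: "n > 0" for n
  proof -
    obtain \<delta> where \<delta>: "geodesic \<delta>" "\<delta> 0 = x\<^sub>0" "\<delta> 1 = L n" using ex_geodesic by blast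
    define \<gamma> where "\<gamma> j s = g (r j) (s * min 1 (real n / D (r j)))" for j s
    have lim: "limitin \<sigma> (\<lambda>j. \<gamma> j s) (\<delta> s) sequentially" if "s \<in> {0..1}" for s
    proof (rule geod[OF _ \<delta>(1) _ _ that])
      show "geodesic (\<gamma> j)" for j
        unfolding \<gamma>_def by (rule geodesic_initial_segment[OF g(1) unit]) simp
      show "limitin \<sigma> (\<lambda>j. \<gamma> j 0) (\<delta> 0) sequentially"
        using start by (simp add: \<gamma>_def g \<delta>)
      show "limitin \<sigma> (\<lambda>j. \<gamma> j 1) (\<delta> 1) sequentially"
        using L[of n] by (simp add: \<gamma>_def \<delta> p_def)
    qed
    have "limitin \<sigma> (\<lambda>j. p (r j) t) (\<delta> (t / real n)) sequentially" if t: "t \<in> {0..real n}" for t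
    proof (rule limitin_transform_eventually[OF _ lim])
      show "t / real n \<in> {0..1}" using t n by simp
      show "eventually (\<lambda>j. \<gamma> j (t / real n) = p (r j) t) sequentially"
        using far_r[of "real n"]
      proof (rule eventually_mono)
        fix j assume Dj: "real n \<le> D (r j)"
        then have "D (r j) > 0" using n by simp
        then show "\<gamma> j (t / real n) = p (r j) t"
          using Dj t n by (simp add: \<gamma>_def p_def)
      qed
    qed
    with \<delta>(1) show ?thesis by blast
  qed
  have "\<exists>y. limitin \<sigma> (\<lambda>j. p (r j) t) y sequentially" if t: "t \<ge> 0" for t
  proof -
    obtain n where "t < real n" using reals_Archimedean2 by blast
    then show ?thesis using segment[of n] t by fastforce
  qed
  then obtain l' where l': "\<And>t. t \<ge> 0 \<Longrightarrow> limitin \<sigma> (\<lambda>j. p (r j) t) (l' t) sequentially"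
    by metis
  define l where "l = restrict l' {0..}"
  have l: "limitin \<sigma> (\<lambda>j. p (r j) t) (l t) sequentially" if "t \<ge> 0" for t
    using l'[OF that] that by (simp add: l_def)
  define c where "c = dist (l 0) (l 1)"
  have l0: "l 0 = x\<^sub>0"
    using unique[OF l[of 0]] start by (simp add: p_def g)
  have ray: "dist (l s) (l t) = c * \<bar>s - t\<bar>" if st: "s \<ge> 0" "t \<ge> 0" for s t
  proof -
    obtain n where n: "max 1 (max s t) < real n" using reals_Archimedean2 by blast
    then have n0: "n > 0" by (cases n) auto
    obtain \<delta> where \<delta>: "geodesic \<delta>"
      "\<And>t. t \<in> {0..real n} \<Longrightarrow> limitin \<sigma> (\<lambda>j. p (r j) t) (\<delta> (t / real n)) sequentially"
      using segment[OF n0] by blast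
    have eq: "l u = \<delta> (u / real n)" if "u \<in> {0..real n}" for u
      by (rule unique[OF l \<delta>(2)]) (use that in auto)
    have dist_eq: "dist (l u) (l v) = \<bar>u - v\<bar> / real n * dist (\<delta> 0) (\<delta> 1)"
      if uv: "u \<in> {0..real n}" "v \<in> {0..real n}" for u v
    proof -
      have "dist (\<delta> (u / real n)) (\<delta> (v / real n)) = \<bar>u / real n - v / real n\<bar> * dist (\<delta> 0) (\<delta> 1)"
        using uv n0 by (intro geodesic_dist[OF \<delta>(1)]) auto
      then show ?thesis
        using n0 by (simp add: eq[OF uv(1)] eq[OF uv(2)] diff_divide_distrib[symmetric])
    qed
    have "dist (l s) (l t) = \<bar>s - t\<bar> / real n * dist (\<delta> 0) (\<delta> 1)"
      by (rule dist_eq) (use st n in auto)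
    moreover have "c = \<bar>0 - 1\<bar> / real n * dist (\<delta> 0) (\<delta> 1)"
      unfolding c_def by (rule dist_eq) (use n in auto)
    ultimately show ?thesis by simp
  qed
  have "ereal c \<le> liminf (\<lambda>j. ereal (dist (p (r j) 0) (p (r j) 1)))"
    unfolding c_def by (intro lsc p_bounded l) auto
  also have "\<dots> \<le> liminf (\<lambda>j::nat. ereal 1)"
    using p_dist[of 1] by (intro Liminf_mono) (simp add: p_def g)
  finally have c1: "c \<le> 1" by (simp add: Liminf_const)
  have c0: "c \<ge> 0" by (simp add: c_def)
  have "l \<in> rays x\<^sub>0"
    unfolding rays_def using l0 ray c0 by (auto simp: l_def)
  moreover have "weakly_converges (\<lambda>j. g (r j) (min 1 (t / dist x\<^sub>0 (g (r j) 1)))) (l t)"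
    if "t \<ge> 0" for t
    using weak[OF p_bounded l] that by (simp add: p_def D_def)
  ultimately show ?thesis
    using r c0 c1 ray by (intro exI[of _ r] exI[of _ l] exI[of _ c] conjI allI impI)
qed

section \<open>The infimum of the slope as a maximum over rays\<close>

theorem theorem4p1:
  fixes \<sigma> :: "'a::hadamard_space topology"
    and F G :: "'a \<Rightarrow> ereal"
    and x\<^sub>0 :: 'a
  assumes "compatible_topology \<sigma>"
    and "\<And>x. F x \<noteq> -\<infinity>" and "geodesically_convex F" and "lower_semicontinuous F"
    and "\<And>x. G x \<noteq> -\<infinity>" and "geodesically_convex G" and "lower_semicontinuous G"
    and "\<And>x. F x \<le> G x"
    and "\<And>c. c \<in> Dom F \<Longrightarrow> antimono_on {0..} (\<lambda>t. G (gradient_flow F c t))"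
    and "x\<^sub>0 \<in> Dom G"
    and "\<And>C :: real. C > 0 \<Longrightarrow>
           sequentially_compactin \<sigma> {x. dist x x\<^sub>0 \<le> C \<and> G x \<le> ereal C}"
  shows "is_maximum
           ({0} \<union> (\<lambda>l. - radial F l / ereal (ray_norm l)) ` (rays x\<^sub>0 - {constant_ray x\<^sub>0}))
           (INF x. slope F x)"
proof -
  obtain b where b: "G x\<^sub>0 = ereal b" using assms(5)[of x\<^sub>0] assms(10) by (cases "G x\<^sub>0") (auto simp: Dom_def)
  have "F x\<^sub>0 \<le> ereal b" using assms(8)[of x\<^sub>0] b by simp
  then have D\<^sub>0: "x\<^sub>0 \<in> Dom F" using assms(2)[of x\<^sub>0] by (cases "F x\<^sub>0") (auto simp: Dom_def)
  interpret F: convex_lsc_function F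
    using assms(2-4) D\<^sub>0 by unfold_locales auto
  interpret G: convex_lsc_function G
    using assms(5-7,10) by unfold_locales auto
  have ray_le: "- radial F l / ereal (ray_norm l) \<le> (INF x. slope F x)"
    if l: "l \<in> rays x\<^sub>0" "l \<noteq> constant_ray x\<^sub>0" for l
  proof -
    obtain c where c: "c \<ge> 0" "\<And>s t. s \<ge> 0 \<Longrightarrow> t \<ge> 0 \<Longrightarrow> dist (l s) (l t) = c * \<bar>s - t\<bar>"
      and l0: "l 0 = x\<^sub>0" and ext: "l \<in> extensional {0..}"
      using l(1) by (auto simp: rays_def)
    have "c \<noteq> 0"
    proof
      assume "c = 0"
      then have "l t = x\<^sub>0" if "t \<ge> 0" for t using c(2)[OF that, of 0] l0 by simp
      then have "l = constant_ray x\<^sub>0"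
        unfolding constant_ray_def by (intro extensionalityI[OF ext]) auto
      then show False using l(2) by simp
    qed
    then show ?thesis
      using F.minus_radial_le_slope[of l c, OF c(2)] c(1) c(2)[of 0 1] l0 D\<^sub>0
      by (auto simp: ray_norm_def intro!: INF_greatest)
  qed
  have nonneg: "0 \<le> (INF x. slope F x)" by (intro INF_greatest slope_nonneg)
  have Inf_le: "(INF x. slope F x) \<le> ereal (dist u (resolvent F \<tau> u) / \<tau>)" if "\<tau> > 0" for u \<tau>
    using INF_lower[OF UNIV_I, of "slope F" "resolvent F \<tau> u"] F.slope_resolvent_le[OF that, of u]
    by (rule order.trans)
  obtain s where s: "(INF x. slope F x) = ereal s" "s \<ge> 0"
    using nonneg Inf_le[of 1 x\<^sub>0] by (cases "INF x. slope F x") auto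
  have step: "s * \<tau> \<le> dist u (resolvent F \<tau> u)" if "\<tau> > 0" for u \<tau>
    using Inf_le[OF that, of u] that by (simp add: s pos_le_divide_eq)
  have "ereal s \<in> {0} \<union> (\<lambda>l. - radial F l / ereal (ray_norm l)) ` (rays x\<^sub>0 - {constant_ray x\<^sub>0})"
  proof (cases "s = 0")
    case True
    then show ?thesis by (simp add: zero_ereal_def)
  next
    case False
    then have s0: "s > 0" using s by simp
    \<comment> \<open>Positive times only, where the flow is given by resolvents with positive steps.\<close>
    define y where "y k = gradient_flow F x\<^sub>0 (real (Suc k))" for k
    have y: "y k \<in> Dom F" "s * dist x\<^sub>0 (y k) \<le> F.f x\<^sub>0 - F.f (y k)"
      "s\<^sup>2 * real (Suc k) \<le> F.f x\<^sub>0 - F.f (y k)" for k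
    proof -
      have k: "real (Suc k) > 0" by simp
      show "y k \<in> Dom F" "s * dist x\<^sub>0 (y k) \<le> F.f x\<^sub>0 - F.f (y k)"
        "s\<^sup>2 * real (Suc k) \<le> F.f x\<^sub>0 - F.f (y k)"
        using F.gradient_flow_decrease[OF D\<^sub>0 k s(2) step] unfolding y_def by blast+
    qed
    have Gy: "G (y k) \<le> ereal b" for k
      using monotone_onD[OF assms(9)[OF D\<^sub>0], of 0 "real (Suc k)"] b
      by (simp add: y_def gradient_flow_0)
    obtain \<rho> where \<rho>: "\<rho> > 0" "\<And>x. x \<in> Dom F \<Longrightarrow> F.f x\<^sub>0 - 1 - dist x\<^sub>0 x / \<rho> \<le> F.f x"
      using F.linear_lower_bound[OF D\<^sub>0] by blast
    \<comment> \<open>\<open>F\<close> tends to \<open>-\<infinity>\<close> along \<open>y\<close>, but is bounded below on bounded sets.\<close>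
    have far: "filterlim (\<lambda>k. dist x\<^sub>0 (y k)) at_top sequentially"
      unfolding filterlim_at_top
    proof
      fix Z :: real
      show "eventually (\<lambda>k. Z \<le> dist x\<^sub>0 (y k)) sequentially"
        using eventually_ge_at_top[of "nat \<lceil>(Z / \<rho> + 1) / s\<^sup>2\<rceil>"]
      proof (rule eventually_mono)
        fix k assume "nat \<lceil>(Z / \<rho> + 1) / s\<^sup>2\<rceil> \<le> k"
        then have "(Z / \<rho> + 1) / s\<^sup>2 \<le> real k" by linarith
        then have "Z / \<rho> + 1 \<le> s\<^sup>2 * real k" using s0 by (simp add: divide_le_eq mult.commute)
        also have "\<dots> \<le> s\<^sup>2 * real (Suc k)" by (intro mult_left_mono) auto
        finally have "Z / \<rho> \<le> dist x\<^sub>0 (y k) / \<rho>"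
          using y(3)[of k] \<rho>(2)[OF y(1)[of k]] by linarith
        then show "Z \<le> dist x\<^sub>0 (y k)" using \<rho>(1) by (simp add: divide_le_cancel)
      qed
    qed
    have "\<forall>k. \<exists>\<gamma>. geodesic \<gamma> \<and> \<gamma> 0 = x\<^sub>0 \<and> \<gamma> 1 = y k"
      using ex_geodesic by blast
    then obtain g where g: "\<And>k. geodesic (g k)" "\<And>k. g k 0 = x\<^sub>0" "\<And>k. g k 1 = y k"
      by (auto dest!: choice)
    have compact: "\<forall>X. bounded (range X) \<and> range X \<subseteq> {x. G x \<le> ereal b} \<longrightarrow>
      (\<exists>l r. strict_mono (r :: nat \<Rightarrow> nat) \<and> limitin \<sigma> (X \<circ> r) l sequentially)"
    proof (intro allI impI, elim conjE)
      fix X :: "nat \<Rightarrow> 'a" assume X: "bounded (range X)" "range X \<subseteq> {x. G x \<le> ereal b}"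
      obtain e where e: "\<And>j. dist (X j) x\<^sub>0 \<le> e"
        using X(1) by (auto simp: bounded_any_center[of _ x\<^sub>0] dist_commute)
      define C where "C = max 1 (max e b)"
      then have C: "C > 0" "e \<le> C" "b \<le> C" by auto
      have "X j \<in> {x. dist x x\<^sub>0 \<le> C \<and> G x \<le> ereal C}" for j
        using e[of j] order.trans[of "G (X j)" "ereal b" "ereal C"] X(2) C by auto
      then show "\<exists>l r. strict_mono (r :: nat \<Rightarrow> nat) \<and> limitin \<sigma> (X \<circ> r) l sequentially"
        using assms(11)[OF C(1)] unfolding sequentially_compactin_def by blast
    qed
    have GA: "g k ` {0..1} \<subseteq> {x. G x \<le> ereal b}" for k
    proof
      fix x assume "x \<in> g k ` {0..1}"
      then obtain t where t: "t \<in> {0..1}" and x: "x = g k t" by blast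
      show "x \<in> {x. G x \<le> ereal b}"
        unfolding x by (rule geodesically_convex_setD[OF G.sublevel_convex g(1) _ _ t])
          (use g Gy[of k] b in simp_all)
    qed
    obtain r l c where r: "strict_mono (r :: nat \<Rightarrow> nat)" and c: "0 \<le> c" "c \<le> 1" and l: "l \<in> rays x\<^sub>0"
      and "\<forall>s\<ge>0. \<forall>t\<ge>0. dist (l s) (l t) = c * \<bar>s - t\<bar>"
      and "\<forall>t\<ge>0. weakly_converges (\<lambda>j. g (r j) (min 1 (t / dist x\<^sub>0 (g (r j) 1)))) (l t)"
      using limit_ray[OF assms(1) g(1,2) far[folded g(3)] compact GA]
      by (elim exE conjE) (rule that)
    then have dist_l: "\<And>s t. 0 \<le> s \<Longrightarrow> 0 \<le> t \<Longrightarrow> dist (l s) (l t) = c * \<bar>s - t\<bar>"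
      and lim: "\<And>t. 0 \<le> t \<Longrightarrow>
        weakly_converges (\<lambda>j. g (r j) (min 1 (t / dist x\<^sub>0 (g (r j) 1)))) (l t)"
      by (simp_all only:)
    have l0: "l 0 = x\<^sub>0" using l by (simp add: rays_def)
    have F_l: "F (l t) \<le> ereal (F.f x\<^sub>0 - s * t)" if t: "t \<ge> 0" for t
    proof (rule F.weak_limit_le[OF lim[OF t]])
      have "filterlim (\<lambda>j. dist x\<^sub>0 (y (r j))) at_top sequentially"
        by (rule filterlim_compose[OF far filterlim_subseq[OF r]])
      then have "eventually (\<lambda>j. max 1 t \<le> dist x\<^sub>0 (y (r j))) sequentially"
        by (simp only: filterlim_at_top)
      then show "eventually (\<lambda>j. F (g (r j) (min 1 (t / dist x\<^sub>0 (g (r j) 1))))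
          \<le> ereal (F.f x\<^sub>0 - s * t)) sequentially"
      proof (rule eventually_mono)
        fix j assume j: "max 1 t \<le> dist x\<^sub>0 (y (r j))"
        define d u where "d = dist x\<^sub>0 (y (r j))" and "u = t / d"
        have d: "d > 0" "t \<le> d" using j by (auto simp: d_def)
        have u: "u \<in> {0..1}" "u * d = t" using d t by (auto simp: u_def)
        have "F.f (g (r j) u) \<le> (1 - u) * F.f x\<^sub>0 + u * F.f (y (r j))"
          using F.f_geodesic_le[OF g(1) _ _ u(1), of "r j"] D\<^sub>0 y(1)[of "r j"] by (simp add: g)
        also have "\<dots> = F.f x\<^sub>0 - u * (F.f x\<^sub>0 - F.f (y (r j)))" by (simp add: algebra_simps)
        also have "\<dots> \<le> F.f x\<^sub>0 - u * (s * d)"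
          using y(2)[of "r j"] u by (intro diff_left_mono mult_left_mono) (auto simp: d_def)
        also have "u * (s * d) = s * t" using u by (simp add: algebra_simps)
        finally have "F.f (g (r j) u) \<le> F.f x\<^sub>0 - s * t" .
        moreover have "g (r j) u \<in> Dom F"
          using F.geodesic_in_Dom[OF g(1) _ _ u(1), of "r j"] D\<^sub>0 y(1)[of "r j"] by (simp add: g)
        moreover have "min 1 (t / dist x\<^sub>0 (g (r j) 1)) = u"
          using u by (simp add: g u_def d_def)
        ultimately show "F (g (r j) (min 1 (t / dist x\<^sub>0 (g (r j) 1)))) \<le> ereal (F.f x\<^sub>0 - s * t)"
          by (simp add: F.f_le_iff)
      qed
    qed
    \<comment> \<open>The limit of the geodesics does not collapse to \<open>x\<^sub>0\<close>: \<open>F\<close> has dropped by \<open>s\<close> at time \<open>1\<close>.\<close>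
    have "c \<noteq> 0"
    proof
      assume "c = 0"
      then have "l 1 = x\<^sub>0" using dist_l[of 0 1] l0 by simp
      then show False using F_l[of 1] D\<^sub>0 s0 by (simp add: F.f_le_iff)
    qed
    then have c0: "c > 0" using c by simp
    have norm_l: "ray_norm l = c" using dist_l[of 0 1] by (simp add: ray_norm_def)
    have nonconst: "l \<noteq> constant_ray x\<^sub>0"
      using norm_l c0 by (auto simp: ray_norm_def constant_ray_def)
    have "radial F l \<le> ereal (- s)"
    proof (rule tendsto_le[OF _ _ F.radial_LIMSEQ[OF dist_l]])
      have "((\<lambda>t. F.f x\<^sub>0 / t - s) \<longlongrightarrow> 0 - s) at_top"
        by (intro tendsto_intros tendsto_divide_0[OF tendsto_const] filterlim_at_top_imp_at_infinity filterlim_ident)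
      then show "((\<lambda>t. ereal (F.f x\<^sub>0 / t - s)) \<longlongrightarrow> ereal (- s)) at_top" by simp
      show "eventually (\<lambda>t. F (l t) / ereal t \<le> ereal (F.f x\<^sub>0 / t - s)) at_top"
        using eventually_gt_at_top[of 0]
      proof (rule eventually_mono)
        fix t :: real assume t: "t > 0"
        then have "F (l t) / ereal t \<le> ereal (F.f x\<^sub>0 - s * t) / ereal t"
          using F_l[of t] by (intro ereal_divide_right_mono) auto
        then show "F (l t) / ereal t \<le> ereal (F.f x\<^sub>0 / t - s)"
          using t by (simp add: diff_divide_distrib)
      qed
    qed (use l0 D\<^sub>0 in auto)
    then have "ereal s \<le> - radial F l / ereal c"
    proof (cases "radial F l")
      case (real q)
      then have "s \<le> - q" using \<open>radial F l \<le> ereal (- s)\<close> by simp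
      moreover have "s * c \<le> s * 1" using c s0 by (intro mult_left_mono) auto
      ultimately have "s * c \<le> - q" by simp
      then have "s \<le> - q / c" using c0 by (simp only: pos_le_divide_eq)
      then show ?thesis using real c0 by simp
    qed (use c0 in auto)
    then have "ereal s = - radial F l / ereal (ray_norm l)"
      using ray_le[OF l nonconst] by (simp add: norm_l s)
    then show ?thesis using l nonconst by blast
  qed
  then show ?thesis
    unfolding is_maximum_def s(1)[symmetric] using nonneg ray_le by auto
qed

end
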